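(* Let $F$ be the $3$-uniform graph on vertex set $\{1,\dots,7\}$ with edge set $\{123,124,134,234,567\}$ (the disjoint union of $K_4^3$ and one edge, denoted $K_4^3\cup e$). Then $\pi_\lambda(K_4^3\cup e)=\frac{\sqrt3}{3}$.
   Context: An $r$-uniform graph ($r$-graph) $G$ is a vertex set $V(G)$ with an edge set $E(G)\subseteq \binom{V(G)}{r}$. $K_t^r$ is the complete $r$-graph on $t$ vertices. For an $r$-graph $G$ on $[n]$ and $\vec x\in[0,\infty)^n$, $\lambda(G,\vec x)=\sum_{e\in E(G)}\prod_{i\in e}x_i$, and the Lagrangian is $\lambda(G)=\max\{\lambda(G,\vec x):\ \sum_i x_i=1,\ x_i\ge 0\}$. A graph $G$ is $F$-free if it contains no subgraph isomorphic to $F$. The Lagrangian density of an $r$-graph $F$ is $\pi_\lambda(F)=\sup\{r!\,\lambda(G): G \text{ is an } F\text{-free } r\text{-graph}\}$. *)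

theory Defs
  imports Complex_Main
begin

definition is_rgraph :: "nat \<Rightarrow> nat \<Rightarrow> nat set set \<Rightarrow> bool" where
  "is_rgraph r n E \<longleftrightarrow> (\<forall>e\<in>E. e \<subseteq> {0..<n} \<and> card e = r)"

definition lam_poly :: "nat set set \<Rightarrow> (nat \<Rightarrow> real) \<Rightarrow> real" where
  "lam_poly E x = (\<Sum>e\<in>E. \<Prod>i\<in>e. x i)"

definition simplex :: "nat \<Rightarrow> (nat \<Rightarrow> real) set" where
  "simplex n = {x. (\<forall>i<n. 0 \<le> x i) \<and> (\<Sum>i<n. x i) = 1}"

text \<open>The Lagrangian of a graph on [n] (the maximum is attained, so it equals the supremum).\<close>
definition lagrangian :: "nat \<Rightarrow> nat set set \<Rightarrow> real" where
  "lagrangian n E = Sup (lam_poly E ` simplex n)"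

definition contains_copy :: "'a set \<Rightarrow> 'a set set \<Rightarrow> 'b set \<Rightarrow> 'b set set \<Rightarrow> bool" where
  "contains_copy VF EF VG EG \<longleftrightarrow>
     (\<exists>f. inj_on f VF \<and> f ` VF \<subseteq> VG \<and> (\<forall>e\<in>EF. f ` e \<in> EG))"

text \<open>Lagrangian density of an r-graph F = (VF, EF): sup of r! lambda(G) over F-free r-graphs G
  (on [n], n \<ge> 1, so that the simplex is nonempty).\<close>
definition lagrangian_density :: "nat \<Rightarrow> 'a set \<Rightarrow> 'a set set \<Rightarrow> real" where
  "lagrangian_density r VF EF =
     Sup {fact r * lagrangian n E | n E. 1 \<le> n \<and> is_rgraph r n E \<and> \<not> contains_copy VF EF {0..<n} E}"

definition K43_e_vertices :: "nat set" where
  "K43_e_vertices = {1..7}"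

definition K43_e_edges :: "nat set set" where
  "K43_e_edges = {{1,2,3},{1,2,4},{1,3,4},{2,3,4},{5,6,7}}"

end

theory Submission
  imports Defs
begin

text \<open>
  The lower bound comes from the graphs of all triples meeting a fixed pair of vertices.
  For the upper bound, let \<open>G\<close> be free and \<open>x\<close> a point of the simplex.

  If \<open>G\<close> has no \<open>K\<^sub>4\<close>, a flag algebra computation on five vertices already gives
  \<open>6 \<lambda>(G,x) \<le> 577/1000 < sqrt 3 / 3\<close>; as blow-ups of \<open>G\<close> stay \<open>K\<^sub>4\<close>-free, sampling five vertices
  with repetition from the weights \<open>x\<close> is harmless.

  Otherwise fix a \<open>K\<^sub>4\<close> on \<open>T\<close>; every edge meets \<open>T\<close>, so \<open>\<lambda>(G,x)\<close> is an average, over two vertices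
  \<open>u, v\<close> sampled outside \<open>T\<close>, of an expression in the edges within \<open>T \<union> {u,v}\<close>. If no \<open>K\<^sub>4\<close> meets \<open>T\<close> in exactly
  two vertices, this expression is always below \<open>sqrt 3 / 18\<close>. If some \<open>K\<^sub>4\<close> shares exactly the pair
  \<open>{a,b}\<close> with \<open>T\<close>, compare with the graph of all triples meeting \<open>{a,b}\<close>: the additional edges avoid
  \<open>{a,b}\<close> and cross between the two remaining pairs, and each of them rules out every \<open>K\<^sub>4\<close> that contains
  \<open>{a,b}\<close> and is disjoint from it, which costs more than it gains.
\<close>

section \<open>Polynomial inequalities\<close>

lemmas poly_simps = algebra_simps power2_eq_square power3_eq_cube add_divide_distrib diff_divide_distrib

text \<open>The sums of squares and monomials below are rounded semidefinite programming certificates.\<close>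

lemma link_bound_3:
  fixes m k q :: real
  assumes "0 \<le> m" "0 \<le> k" "0 \<le> q" "m + k + q = 1"
  shows "m^3/27 + k * (m^2/3) + q * (m * k + m^2/6) + q^2 * m/2 \<le> 12/125"
proof -
  have "12/125 * (m + k + q)^3 - (m^3/27 + k * (m^2/3) + q * (m * k + m^2/6) + q^2 * m/2) =
      1/20 * m * (m - 69/40 * k - 3/5 * q)^2 + 3/20 * m * (k - 3/40 * q)^2
       + 1/8 * k * (m - 1/10 * k - 3/4 * q)^2 + 3/40 * k * (k - 3/40 * q)^2
       + 7/40 * q * (m - 37/40 * k - 7/10 * q)^2 + 1/8 * q * (k - 3/40 * q)^2 + 611/64000 * q^3
       + 601/64000 * k * q^2 + 369/64000 * k^2 * q + 79/4000 * k^3 + 453/32000 * m * q^2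
       + 1/160 * m * k * q + 91/6400 * m * k^2 + 19/3000 * m^2 * q + 13/6000 * m^2 * k
       + 121/13500 * m^3"
    by (simp add: poly_simps)
  also have "\<dots> \<ge> 0"
    using assms(1-3) by (intro add_nonneg_nonneg mult_nonneg_nonneg) auto
  finally show ?thesis using assms(4) by simp
qed

text \<open>Here two of the four vertices of a \<open>K4\<close>, of joint weight \<open>m\<close>,
  form an edge with the sampled outside pair; \<open>k\<close> is the weight of the other two and
  \<open>q\<close> the weight outside. Products within a block are already replaced by their value
  at equal weights. The numeral in \<open>link_bound_1\<close> to \<open>link_bound_4\<close> counts
  the joined vertices.\<close>

lemma link_bound_2:
  fixes m k q :: real
  assumes "0 \<le> m" "0 \<le> k" "0 \<le> q" "m + k + q = 1"
  shows "k * (m^2/4) + m * (k^2/4) + q * (m * k + m^2/8 + k^2/4) + q^2 * m/2 \<le> 12/125"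
proof -
  have "12/125 * (m + k + q)^3 - (k * (m^2/4) + m * (k^2/4) + q * (m * k + m^2/8 + k^2/4) + q^2 * m/2) =
      1/12 * m * (m - 7/12 * k - 13/24 * q)^2 + 1/8 * k * (m - 1/12 * k - 5/6 * q)^2
       + 1/12 * k * (k - 13/24 * q)^2 + 1/4 * q * (m - 7/12 * k - 13/24 * q)^2 + 6523/288000 * q^3
       + 16207/864000 * k * q^2 + 1861/72000 * k^2 * q + 1699/144000 * k^3 + 29707/864000 * m * q^2
       + 5041/216000 * m * k * q + 6583/216000 * m * k^2 + 59/18000 * m^2 * q + 23/2250 * m^2 * k
       + 19/1500 * m^3"
    by (simp add: poly_simps)
  also have "\<dots> \<ge> 0"
    using assms(1-3) by (intro add_nonneg_nonneg mult_nonneg_nonneg) auto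
  finally show ?thesis using assms(4) by simp
qed

lemma link_bound_1:
  fixes m k q :: real
  assumes "0 \<le> m" "0 \<le> k" "0 \<le> q" "m + k + q = 1"
  shows "m * (k^2/3) + k^3/27 + q * (m * k + k^2/3) + q^2 * m/2 \<le> 12/125"
proof -
  have "12/125 * (m + k + q)^3 - (m * (k^2/3) + k^3/27 + q * (m * k + k^2/3) + q^2 * m/2) =
      1/15 * m * (m - 2/15 * k - 11/30 * q)^2 + 1/30 * m * (k - 8/15 * q)^2 + 1/30 * m * (q)^2
       + 3/10 * k * (m - 2/15 * k - 1/2 * q)^2 + 1/30 * k * (k - 3/2 * q)^2 + 1/15 * k * (q)^2
       + 1/3 * q * (m - 1/6 * k - 2/5 * q)^2 + 1/30 * q * (q)^2 + 7/750 * q^3 + 121/4500 * k * q^2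
       + 73/13500 * k^2 * q + 137/6750 * k^3 + 13/4500 * m * q^2 + 109/6750 * m * k * q
       + 1/6750 * m * k^2 + 4/1125 * m^2 * q + 13/2250 * m^2 * k + 11/375 * m^3"
    by (simp add: poly_simps)
  also have "\<dots> \<ge> 0"
    using assms(1-3) by (intro add_nonneg_nonneg mult_nonneg_nonneg) auto
  finally show ?thesis using assms(4) by simp
qed

text \<open>
  The threshold \<open>97/200\<close> is chosen so that both \<open>core_bound_outer\<close> below it and
  \<open>core_bound_heavy_pair\<close> above it stay under \<open>sqrt 3 / 18\<close>.
\<close>

lemma two_root_bound:
  fixes a b :: real
  assumes "0 \<le> b" "b \<le> a" "a + b \<le> 97/200"
  shows "(a + b) * (1 - a - b)^2/2 + 3/2 * a^2 * b + a * b * (a + b)/8 + 16/243 * (1 - a - b - a/2)^3 \<le> 481/5000"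
proof -
  \<comment> \<open>In the coordinates \<open>b\<close>, \<open>t\<close>, \<open>s\<close> the
    region is the part of the nonnegative orthant with \<open>2 * b + t + s = 97/200\<close>.
    Inserting powers of \<open>e\<close>, which equals 1 there, makes both sides homogeneous
    cubics.\<close>
  define t where "t = a - b"
  define s where "s = 97/200 - a - b"
  have nn: "0 \<le> t" "0 \<le> s" using assms by (auto simp: t_def s_def)
  have a: "a = b + t" and one: "200/97 * (2 * b + t + s) = 1" by (auto simp: t_def s_def)
  have "481/5000 * e^3 - ((a + b) * (e - a - b)^2/2 + 3/2 * a^2 * b + a * b * (a + b)/8 + 16/243 * (e - a - b - a/2)^3) =
      9/50 * b * (b - 32/25 * t - 14/25 * s)^2 + 1/50 * b * (s)^2
       + 7/50 * t * (b - 32/25 * t + 6/25 * s)^2 + 7/50 * t * (s)^2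
       + 12/25 * s * (b + 7/25 * t - 17/25 * s)^2 + 13/50 * s * (t - 1/10 * s)^2 + 1/50 * s * (s)^2
       + 597021272309/27722442375000 * s^3 + 4386585023/231020353125 * t * s^2
       + 305219531/2310203531250 * t^2 * s + 266233405073/6930610593750 * t^3
       + 5393380627/256689281250 * b * s^2 + 3094622926/128344640625 * b * t * s
       + 14426303227/1026757125000 * b * t^2 + 5194898/570420625 * b^2 * s
       + 31130617/4563365000 * b^2 * t + 2179911/91267300 * b^3" if e: "e = 200/97 * (2 * b + t + s)" for e
    unfolding a e by (simp add: poly_simps)
  from this[OF one[symmetric]] have "481/5000 - ((a + b) * (1 - a - b)^2/2 + 3/2 * a^2 * b + a * b * (a + b)/8 + 16/243 * (1 - a - b - a/2)^3) =
      9/50 * b * (b - 32/25 * t - 14/25 * s)^2 + 1/50 * b * (s)^2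
       + 7/50 * t * (b - 32/25 * t + 6/25 * s)^2 + 7/50 * t * (s)^2
       + 12/25 * s * (b + 7/25 * t - 17/25 * s)^2 + 13/50 * s * (t - 1/10 * s)^2 + 1/50 * s * (s)^2
       + 597021272309/27722442375000 * s^3 + 4386585023/231020353125 * t * s^2
       + 305219531/2310203531250 * t^2 * s + 266233405073/6930610593750 * t^3
       + 5393380627/256689281250 * b * s^2 + 3094622926/128344640625 * b * t * s
       + 14426303227/1026757125000 * b * t^2 + 5194898/570420625 * b^2 * s
       + 31130617/4563365000 * b^2 * t + 2179911/91267300 * b^3"
    by simp
  also have "\<dots> \<ge> 0"
    using nn assms(1) by (intro add_nonneg_nonneg mult_nonneg_nonneg) auto
  finally show ?thesis by simp
qed

lemma link_bound_4:
  fixes p q :: real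
  assumes "0 \<le> p" "0 \<le> q" "p + q = 1"
  shows "p^3/16 + q * (3/16 * p^2) + q^2 * p/2 \<le> 12/125"
proof -
  have q: "q = 1 - p" using assms by simp
  \<comment> \<open>The left side peaks at \<open>p = 4/9\<close>, which 89/200 approximates. The
    remainder after the square is linear in \<open>p\<close> with positive coefficients.\<close>
  have "12/125 - (p^3/16 + q * (3/16 * p^2) + q^2 * p/2) = (p - 89/200)^2 * (383/800 - 3/8 * p) + (12/125 - 89^2/200^2 * 383/800)
     - (1/2 - 89/100 * 383/800 - 3/8 * 89^2/200^2) * p"
    unfolding q by (simp add: poly_simps)
  also have "\<dots> \<ge> 0"
  proof -
    have "0 \<le> (p - 89/200)^2 * (383/800 - 3/8 * p)" using assms by (intro mult_nonneg_nonneg) auto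
    then show ?thesis using assms by (simp add: field_simps)
  qed
  finally show ?thesis by simp
qed

section \<open>The target value and the inequalities for two copies of \<open>K4\<close> sharing a
  pair\<close>

lemma sqrt3_bound: "481/5000 \<le> sqrt 3 / 18"
proof -
  \<comment> \<open>This is 18 times 481/5000, the rational stand-in for the target in all cases
    that leave some slack.\<close>
  have "4329/2500 \<le> sqrt 3" by (rule real_le_rsqrt) (simp add: power2_eq_square)
  then show ?thesis by simp
qed

text \<open>\<open>(z - z^3)/4\<close> is the limiting value of the graph of all triples meeting a
  pair, when the pair shares the weight \<open>1 - z\<close> equally and \<open>z\<close> is spread
  thinly. The difference to the bound has the double root \<open>s = sqrt 3 / 3\<close> and the
  simple root \<open>- 2 * s\<close>.\<close>

lemma cubic_le_sqrt3:
  fixes z :: real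
  assumes "0 \<le> z"
  shows "(z - z^3)/4 \<le> sqrt 3 / 18"
proof -
  define s where "s = sqrt 3 / 3"
  have s: "s * s = 1/3" "0 \<le> s" by (simp_all add: s_def)
  have "0 \<le> (z - s)^2 * (z + 2 * s)" using assms s by (intro mult_nonneg_nonneg) auto
  also have "\<dots> = z^3 - 3 * (s * s) * z + 2 * (s * s) * s"
    by (simp add: poly_simps)
  finally show ?thesis unfolding s(1) by (simp add: s_def)
qed

text \<open>Evening out the weights inside \<open>{c,d}\<close> and inside \<open>{u,v}\<close> only
  increases the weight of the triples crossing between these pairs.\<close>

lemma cross_bound:
  fixes c d u v :: real
  assumes "0 \<le> c" "0 \<le> d" "0 \<le> u" "0 \<le> v"
  shows "c * d * (u + v) + u * v * (c + d) \<le> (c + d) * (u + v) * (c + d + u + v) / 4"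
proof -
  have "0 \<le> (c - d)^2 * (u + v) + (u - v)^2 * (c + d)" using assms by simp
  then show ?thesis by (simp add: poly_simps)
qed

text \<open>For a given sum \<open>k\<close> the product is largest at \<open>C = U\<close>, and
  \<open>k^2/4 * (A - 3/4 * k)\<close> peaks at \<open>k = 8/9 * A\<close>.\<close>

lemma product_cubic_bound:
  fixes A C U :: real
  assumes "0 \<le> A" "0 \<le> C" "0 \<le> U"
  shows "C * U * (A - 3/4 * (C + U)) \<le> 16/243 * A^3"
proof (cases "3/4 * (C + U) \<le> A")
  case True
  let ?k = "C + U"
  have "C * U \<le> ?k^2/4"
    using zero_le_power2[of "C - U"] by (simp add: poly_simps)
  then have "C * U * (A - 3/4 * ?k) \<le> ?k^2/4 * (A - 3/4 * ?k)"
    using True by (intro mult_right_mono) auto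
  also have "\<dots> = 16/243 * A^3 - (?k - 8/9 * A)^2 * (3/16 * ?k + 1/12 * A)"
    by (simp add: poly_simps)
  also have "\<dots> \<le> 16/243 * A^3"
    using assms by simp
  finally show ?thesis .
next
  case False
  then have "C * U * (A - 3/4 * (C + U)) \<le> 0"
    using assms by (intro mult_nonneg_nonpos) auto
  moreover have "0 \<le> 16/243 * A^3" using assms by simp
  ultimately show ?thesis by linarith
qed

lemma quarter_square: "(a::real) * b \<le> (a + b)^2/4"
  using zero_le_power2[of "a - b"] by (simp add: poly_simps)

lemma sum_squares_bound:
  fixes c d u v :: real
  shows "(c + d)^2/2 + (u + v)^2/2 \<le> c^2 + d^2 + u^2 + v^2"
  using zero_le_power2[of "c - d"] zero_le_power2[of "u - v"] by (simp add: poly_simps)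

text \<open>Serves the case where all edges avoiding the shared pair lie inside
  \<open>{c,d,u,v}\<close>. Compared with \<open>(z - z^3)/4\<close>, these edges and the squares
  they entail change the value by at most \<open>k^2 * (k - 2 * m)/16\<close>.\<close>

lemma core_bound_inner:
  fixes a b c d u v z :: real
  assumes nn: "0 \<le> a" "0 \<le> b" "0 \<le> c" "0 \<le> d" "0 \<le> u" "0 \<le> v"
    and z: "a + b + z = 1" and k: "c + d + u + v \<le> z"
  shows "a * b * z + (a + b)/2 * (z^2 - (c^2 + d^2 + u^2 + v^2)) + (c * d * (u + v) + u * v * (c + d)) \<le> sqrt 3 / 18"
proof -
  define m k where "m = a + b" and "k = c + d + u + v"
  have m0: "0 \<le> m" and k0: "0 \<le> k" and z0: "0 \<le> z" and kz: "k \<le> z" and mz: "m = 1 - z"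
    using assms by (auto simp: m_def k_def)
  have "a * b * z \<le> m^2/4 * z"
    unfolding m_def using quarter_square z0 by (intro mult_right_mono) auto
  moreover have "k^2/4 \<le> c^2 + d^2 + u^2 + v^2"
    using sum_squares_bound[of c d u v] zero_le_power2[of "c + d - u - v"]
    by (simp add: k_def poly_simps)
  then have "m/2 * (z^2 - (c^2 + d^2 + u^2 + v^2)) \<le> m/2 * (z^2 - k^2/4)"
    using m0 by (intro mult_left_mono) auto
  moreover have "c * d * (u + v) + u * v * (c + d) \<le> k^3/16"
  proof -
    have "(c + d) * (u + v) * k \<le> k^2/4 * k"
      using quarter_square[of "c + d" "u + v"] k0 by (intro mult_right_mono) (auto simp: k_def add_ac)
    then show ?thesis using cross_bound[OF nn(3-6)] by (simp add: k_def power2_eq_square power3_eq_cube add_ac)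
  qed
  ultimately have 1: "a * b * z + m/2 * (z^2 - (c^2 + d^2 + u^2 + v^2)) + (c * d * (u + v) + u * v * (c + d))
      \<le> m^2/4 * z + m/2 * (z^2 - k^2/4) + k^3/16"
    by linarith
  also have "\<dots> = (z - z^3)/4 + k^2 * (k - 2 * m)/16"
    unfolding mz by (simp add: poly_simps)
  also have "\<dots> \<le> sqrt 3 / 18"
  proof (cases "k \<le> 2 * m")
    case True
    then have "k^2 * (k - 2 * m) \<le> 0" by (intro mult_nonneg_nonpos) auto
    then show ?thesis using cubic_le_sqrt3[OF z0] by linarith
  next
    \<comment> \<open>Beyond \<open>2 * m\<close> the term increases with \<open>k\<close>, so
      \<open>k = z\<close> is the worst case; the resulting cubic in \<open>z\<close> has its
      maximum 5/54 at \<open>z = 2/3\<close>.\<close>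
    case False
    then have "k^2 * (k - 2 * m) \<le> z^2 * (z - 2 * m)"
      using k0 kz by (intro mult_mono power_mono) auto
    then have "(z - z^3)/4 + k^2 * (k - 2 * m)/16 \<le> (z - z^3)/4 + z^2 * (z - 2 * m)/16" by simp
    also have "\<dots> = 5/54 - (z - 2/3)^2 * (z + 10/3)/16"
      unfolding mz by (simp add: poly_simps)
    also have "\<dots> \<le> 481/5000"
    proof -
      have "0 \<le> (z - 2/3)^2 * (z + 10/3)/16" using z0 by simp
      then show ?thesis by linarith
    qed
    finally show ?thesis using sqrt3_bound by linarith
  qed
  finally show ?thesis unfolding m_def .
qed

text \<open>A heavy pair keeps \<open>z\<close> below the maximiser of \<open>(z - z^3)/4\<close>.
  The slack this leaves absorbs the net gain \<open>C * U * (B - 3/4 * (C + U))\<close> of the edges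
  avoiding the pair, since \<open>B\<close> is small as well.\<close>

lemma core_bound_heavy_pair:
  fixes a b c d u v z :: real
  assumes nn: "0 \<le> a" "0 \<le> b" "0 \<le> c" "0 \<le> d" "0 \<le> u" "0 \<le> v"
    and z: "a + b + z = 1" and k: "c + d + u + v \<le> z" and m: "97/200 \<le> a + b"
  shows "a * b * z + (a + b)/2 * (z^2 - (c^2 + d^2 + u^2 + v^2)) + (c * d * (u + v) + u * v * (c + d))
    + (c + d) * (u + v) * (z - c - d - u - v) \<le> sqrt 3 / 18"
proof -
  define m C U B where "m = a + b" and "C = c + d" and "U = u + v" and "B = z - m/2"
  have CU: "0 \<le> C" "0 \<le> U" "0 \<le> C * U" and z0: "0 \<le> z" and mz: "m = 1 - z" and m0: "0 \<le> m" and z1: "z \<le> 103/200"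
    using assms by (auto simp: m_def C_def U_def)
  have "a * b * z \<le> m^2/4 * z"
    unfolding m_def using quarter_square z0 by (intro mult_right_mono) auto
  moreover have "C * U \<le> c^2 + d^2 + u^2 + v^2"
    using sum_squares_bound[of c d u v] zero_le_power2[of "C - U"]
    by (simp add: C_def U_def poly_simps)
  then have "m/2 * (z^2 - (c^2 + d^2 + u^2 + v^2)) \<le> m/2 * (z^2 - C * U)"
    using m0 by (intro mult_left_mono) auto
  moreover have "c * d * (u + v) + u * v * (c + d) \<le> C * U * (C + U)/4"
    using cross_bound[OF nn(3-6)] by (simp add: C_def U_def add_ac)
  moreover have "(c + d) * (u + v) * (z - c - d - u - v) = C * U * (z - C - U)"
    by (simp add: C_def U_def diff_diff_eq add_ac)
  ultimately have "a * b * z + m/2 * (z^2 - (c^2 + d^2 + u^2 + v^2)) + (c * d * (u + v) + u * v * (c + d))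
      + (c + d) * (u + v) * (z - c - d - u - v)
      \<le> m^2/4 * z + m/2 * (z^2 - C * U) + C * U * (C + U)/4 + C * U * (z - C - U)"
    by linarith
  also have "\<dots> = (z - z^3)/4 + C * U * (B - 3/4 * (C + U))"
    unfolding B_def mz by (simp add: poly_simps)
  also have "\<dots> \<le> 481/5000"
  proof -
    have B1: "B \<le> 109/400" unfolding B_def mz using z1 by (simp add: diff_divide_distrib)
    have "C * U * (B - 3/4 * (C + U)) \<le> C * U * (109/400 - 3/4 * (C + U))"
      using CU(3) B1 by (intro mult_left_mono) auto
    also have "\<dots> \<le> 16/243 * (109/400)^3"
      using CU by (intro product_cubic_bound) auto
    finally have 1: "C * U * (B - 3/4 * (C + U)) \<le> 16/243 * (109/400)^3" .
    have "z^2 \<le> (103/200)^2" using z0 z1 by (intro power_mono) auto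
    \<comment> \<open>The product is the difference of the values of \<open>z - z^3\<close> at
      103/200 and at \<open>z\<close>; both points lie where this function increases.\<close>
    then have "0 \<le> (103/200 - z) * (1 - z^2 - 103/200 * z - (103/200)^2)"
      using z1 by (intro mult_nonneg_nonneg) (auto simp: power2_eq_square)
    then have "z - z^3 \<le> 103/200 - (103/200)^3"
      by (simp add: poly_simps)
    then have "(z - z^3)/4 \<le> (103/200 - (103/200)^3)/4" by simp
    with 1 have "(z - z^3)/4 + C * U * (B - 3/4 * (C + U)) \<le> (103/200 - (103/200)^3)/4 + 16/243 * (109/400)^3"
      by linarith
    also have "\<dots> \<le> 481/5000" by (simp add: power3_eq_cube)
    finally show ?thesis .
  qed
  finally show ?thesis unfolding m_def using sqrt3_bound by linarith
qed

text \<open>Serves a light pair in the presence of an edge \<open>{c,u,w}\<close> leaving both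
  copies of \<open>K4\<close> at \<open>w\<close>. The first four summands are the estimate of
  \<open>pair_loss\<close> for that edge, with only \<open>d\<close> and \<open>v\<close> kept in
  its last sum.\<close>

lemma core_bound_outer:
  fixes a b c d u v w z :: real
  assumes nn: "0 \<le> b" "b \<le> a" "0 \<le> c" "0 \<le> d" "0 \<le> u" "0 \<le> v" "0 \<le> w"
    and z: "a + b + z = 1" and m: "a + b \<le> 97/200"
  shows "a * b * (c + u + w) + a^2 * b/2 + (a + b)/2 * (z^2 - (c^2 + u^2 + w^2)) - a/2 * (d^2 + v^2)
     + (c * d * (u + v) + u * v * (c + d)) + (c + d) * (u + v) * (z - c - d - u - v) \<le> sqrt 3 / 18"
proof -
  define m C U A where "m = a + b" and "C = c + d" and "U = u + v" and "A = z - a/2"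
  have CU: "0 \<le> C" "0 \<le> U" "0 \<le> C * U" and z0: "0 \<le> z" and m0: "0 \<le> m" and a0: "0 \<le> a" and A0: "0 \<le> A"
    using assms by (auto simp: m_def C_def U_def A_def)
  have ab: "a * b * t - b/2 * t^2 \<le> a^2 * b/2" for t
  proof -
    have "0 \<le> b * (a - t)^2" using nn by simp
    then show ?thesis by (simp add: poly_simps)
  qed
  \<comment> \<open>Up to \<open>m/8\<close> the linear term alone is small enough; beyond it
    \<open>a * b\<close> may be raised to \<open>m^2/4\<close>, and a square is left.\<close>
  have w: "a * b * w - m/2 * w^2 \<le> a * b * m/8"
  proof (cases "w \<le> m/8")
    case True
    then have "a * b * w \<le> a * b * (m/8)" using a0 nn by (intro mult_left_mono) auto
    moreover have "0 \<le> m/2 * w^2" using m0 by simp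
    ultimately show ?thesis by simp
  next
    case False
    then have "a * b * (w - m/8) \<le> m^2/4 * (w - m/8)"
      unfolding m_def using quarter_square by (intro mult_right_mono) (auto simp: m_def)
    moreover have "0 \<le> m/2 * (w - m/4)^2" using m0 by simp
    ultimately show ?thesis by (simp add: poly_simps)
  qed
  have "a/2 * (C * U) \<le> a/2 * (c^2 + d^2 + u^2 + v^2)"
    using sum_squares_bound[of c d u v] zero_le_power2[of "C - U"] a0
    by (intro mult_left_mono) (simp_all add: C_def U_def poly_simps)
  moreover have "c * d * (u + v) + u * v * (c + d) \<le> C * U * (C + U)/4"
    using cross_bound[OF nn(3-6)] by (simp add: C_def U_def add_ac)
  moreover have "(c + d) * (u + v) * (z - c - d - u - v) = C * U * (z - C - U)"
    by (simp add: C_def U_def diff_diff_eq add_ac)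
  \<comment> \<open>The squares of \<open>c\<close> and \<open>u\<close> are divided according to
    \<open>m = a + b\<close>: the \<open>b\<close> part pays for \<open>a * b * c\<close> and
    \<open>a * b * u\<close>, the \<open>a\<close> part joins the squares of \<open>d\<close> and
    \<open>v\<close> to pay for \<open>C * U\<close>.\<close>
  moreover have "a * b * (c + u + w) + a^2 * b/2 + (a + b)/2 * (z^2 - (c^2 + u^2 + w^2)) - a/2 * (d^2 + v^2)
    = m/2 * z^2 + a^2 * b/2 + (a * b * c - b/2 * c^2) + (a * b * u - b/2 * u^2) + (a * b * w - m/2 * w^2)
      - a/2 * (c^2 + d^2 + u^2 + v^2)"
    by (simp add: m_def poly_simps)
  moreover have "C * U * (A - 3/4 * (C + U)) = C * U * (z - C - U) + C * U * (C + U)/4 - a/2 * (C * U)"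
    by (simp add: A_def poly_simps)
  moreover note ab[of c] ab[of u] w product_cubic_bound[OF A0 CU(1,2)]
  moreover have "m/2 * z^2 + 3/2 * (a^2 * b) + a * b * m/8 + 16/243 * A^3 \<le> 481/5000"
  proof -
    have "z = 1 - a - b" using z by simp
    then show ?thesis unfolding m_def A_def using two_root_bound[OF nn(1,2) m] by (simp add: mult.assoc)
  qed
  ultimately show ?thesis using sqrt3_bound by linarith
qed

section \<open>Maclaurin inequalities and the link of a \<open>K4\<close>\<close>

lemma esym3_bounds:
  fixes a b c :: real
  assumes "0 \<le> a" "0 \<le> b" "0 \<le> c"
  shows "a * b + a * c + b * c \<le> (a + b + c)^2/3" "a * b * c \<le> (a + b + c)^3/27"
proof -
  have "0 \<le> (a - b)^2 + (a - c)^2 + (b - c)^2" by simp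
  then show 1: "a * b + a * c + b * c \<le> (a + b + c)^2/3"
    by (simp add: poly_simps)
  have "0 \<le> a * (b - c)^2 + b * (a - c)^2 + c * (a - b)^2" using assms by simp
  then have "9 * (a * b * c) \<le> (a + b + c) * (a * b + a * c + b * c)"
    by (simp add: poly_simps)
  also have "\<dots> \<le> (a + b + c) * ((a + b + c)^2/3)"
    using 1 assms by (intro mult_left_mono) auto
  finally show "a * b * c \<le> (a + b + c)^3/27"
    by (simp add: power2_eq_square power3_eq_cube)
qed

lemma esym4_bounds:
  fixes a b c d :: real
  assumes "0 \<le> a" "0 \<le> b" "0 \<le> c" "0 \<le> d"
  shows "a * b + a * c + a * d + b * c + b * d + c * d \<le> 3/8 * (a + b + c + d)^2"
    "a * b * c + a * b * d + a * c * d + b * c * d \<le> (a + b + c + d)^3/16"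
proof -
  have "0 \<le> (a - b)^2 + (a - c)^2 + (a - d)^2 + (b - c)^2 + (b - d)^2 + (c - d)^2" by simp
  then show 1: "a * b + a * c + a * d + b * c + b * d + c * d \<le> 3/8 * (a + b + c + d)^2"
    by (simp add: poly_simps)
  have "0 \<le> a * ((b - c)^2 + (b - d)^2 + (c - d)^2) + b * ((a - c)^2 + (a - d)^2 + (c - d)^2)
     + c * ((a - b)^2 + (a - d)^2 + (b - d)^2) + d * ((a - b)^2 + (a - c)^2 + (b - c)^2)" using assms by simp
  then have "6 * (a * b * c + a * b * d + a * c * d + b * c * d)
      \<le> (a + b + c + d) * (a * b + a * c + a * d + b * c + b * d + c * d)"
    by (simp add: poly_simps)
  also have "\<dots> \<le> (a + b + c + d) * (3/8 * (a + b + c + d)^2)"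
    using 1 assms by (intro mult_left_mono) auto
  finally show "a * b * c + a * b * d + a * c * d + b * c * d \<le> (a + b + c + d)^3/16"
    by (simp add: power2_eq_square power3_eq_cube)
qed

text \<open>
  For a \<open>K\<^sub>4\<close> with vertex weights \<open>a, b, c, d\<close> and two outside vertices \<open>u, v\<close>, the predicates \<open>A, B, C, D\<close> say which of
  its vertices form an edge with \<open>u, v\<close>; each pair of such vertices is then joined to at most one of \<open>u\<close> and \<open>v\<close>.
\<close>

definition link_value :: "real \<Rightarrow> real \<Rightarrow> real \<Rightarrow> real \<Rightarrow> real \<Rightarrow> bool \<Rightarrow> bool \<Rightarrow> bool \<Rightarrow> bool \<Rightarrow> real" where
  "link_value a b c d q A B C D =
    (a * b * c + a * b * d + a * c * d + b * c * d) + q * (a * b + a * c + a * d + b * c + b * d + c * d)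
    - q/2 * (a * b * of_bool (A \<and> B) + a * c * of_bool (A \<and> C) + a * d * of_bool (A \<and> D)
       + b * c * of_bool (B \<and> C) + b * d * of_bool (B \<and> D) + c * d * of_bool (C \<and> D))
    + q^2/2 * (a * of_bool A + b * of_bool B + c * of_bool C + d * of_bool D)"

lemma link_value_swap:
  "link_value a b c d q A B C D = link_value b a c d q B A C D"
  "link_value a b c d q A B C D = link_value a c b d q A C B D"
  "link_value a b c d q A B C D = link_value a b d c q A B D C"
  by (simp_all add: link_value_def conj_commute mult_ac add_ac)

text \<open>Sorted flags leave five patterns. Weights carrying the same flag enter symmetrically, so
  the Maclaurin inequalities reduce each pattern to the joint weights of its blocks.\<close>

lemma link_value_sorted:
  fixes a b c d q :: real
  assumes nn: "0 \<le> a" "0 \<le> b" "0 \<le> c" "0 \<le> d" "0 \<le> q" and sum: "a + b + c + d + q = 1"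
    and sorted: "B \<longrightarrow> A" "C \<longrightarrow> B" "D \<longrightarrow> C"
  shows "link_value a b c d q A B C D \<le> 12/125"
proof -
  consider "A" "B" "C" "D" | "A" "B" "C" "\<not> D" | "A" "B" "\<not> C" "\<not> D" | "A" "\<not> B" "\<not> C" "\<not> D" | "\<not> A" "\<not> B" "\<not> C" "\<not> D"
    using sorted by blast
  then show ?thesis
  proof cases
    case 1
    let ?p = "a + b + c + d"
    have "link_value a b c d q A B C D
        = (a * b * c + a * b * d + a * c * d + b * c * d) + q * ((a * b + a * c + a * d + b * c + b * d + c * d)/2) + q^2 * ?p/2"
      using 1 by (simp add: link_value_def poly_simps)
    also have "\<dots> \<le> ?p^3/16 + q * (3/8 * ?p^2/2) + q^2 * ?p/2"
      using esym4_bounds[OF nn(1-4)] nn(5) by (intro add_mono mult_left_mono) auto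
    also have "\<dots> \<le> 12/125"
      using link_bound_4[of ?p q] nn sum by simp
    finally show ?thesis .
  next
    case 2
    let ?m = "a + b + c" and ?E = "a * b + a * c + b * c"
    have "link_value a b c d q A B C D = a * b * c + d * ?E + q * (?m * d + ?E/2) + q^2 * ?m/2"
      using 2 by (simp add: link_value_def poly_simps)
    also have "\<dots> \<le> ?m^3/27 + d * (?m^2/3) + q * (?m * d + ?m^2/3/2) + q^2 * ?m/2"
      using esym3_bounds[OF nn(1-3)] nn by (intro add_mono mult_left_mono) auto
    also have "\<dots> \<le> 12/125"
      using link_bound_3[of ?m d q] nn sum by simp
    finally show ?thesis .
  next
    case 3
    let ?m = "a + b" and ?k = "c + d"
    have "link_value a b c d q A B C D = ?k * (a * b) + ?m * (c * d) + q * (?m * ?k + a * b/2 + c * d) + q^2 * ?m/2"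
      using 3 by (simp add: link_value_def poly_simps)
    also have "\<dots> \<le> ?k * (?m^2/4) + ?m * (?k^2/4) + q * (?m * ?k + ?m^2/4/2 + ?k^2/4) + q^2 * ?m/2"
      using quarter_square[of a b] quarter_square[of c d] nn
      by (intro add_mono mult_left_mono divide_right_mono) auto
    also have "\<dots> \<le> 12/125"
      using link_bound_2[of ?m ?k q] nn sum by (simp add: add.assoc)
    finally show ?thesis .
  next
    case 4
    let ?k = "b + c + d" and ?E = "b * c + b * d + c * d"
    have "link_value a b c d q A B C D = a * ?E + b * c * d + q * (a * ?k + ?E) + q^2 * a/2"
      using 4 by (simp add: link_value_def poly_simps)
    also have "\<dots> \<le> a * (?k^2/3) + ?k^3/27 + q * (a * ?k + ?k^2/3) + q^2 * a/2"
      using esym3_bounds[OF nn(2-4)] nn by (intro add_mono mult_left_mono) auto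
    also have "\<dots> \<le> 12/125"
      using link_bound_1[of a ?k q] nn sum by (simp add: add.assoc)
    finally show ?thesis .
  next
    case 5
    let ?p = "a + b + c + d"
    have q: "q = 1 - ?p" using sum by simp
    \<comment> \<open>Without flags this is the Lagrangian polynomial of \<open>K_5^3\<close> with
      fifth weight \<open>q\<close>, whose maximum is 2/25.\<close>
    have "link_value a b c d q A B C D
        = (a * b * c + a * b * d + a * c * d + b * c * d) + q * (a * b + a * c + a * d + b * c + b * d + c * d)"
      using 5 by (simp add: link_value_def)
    also have "\<dots> \<le> ?p^3/16 + q * (3/8 * ?p^2)"
      using esym4_bounds[OF nn(1-4)] nn(5) by (intro add_mono mult_left_mono) auto
    also have "\<dots> = 2/25 - (?p - 4/5)^2 * (5/16 * ?p + 1/8)"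
    proof -
      have "p^3/16 + (1 - p) * (3/8 * p^2) = 2/25 - (p - 4/5)^2 * (5/16 * p + 1/8)" for p :: real
        by (simp add: poly_simps)
      then show ?thesis unfolding q .
    qed
    also have "\<dots> \<le> 12/125"
    proof -
      have "0 \<le> (?p - 4/5)^2 * (5/16 * ?p + 1/8)" using nn by simp
      then show ?thesis by linarith
    qed
    finally show ?thesis .
  qed
qed

text \<open>Transpositions sort the flags: \<open>s1\<close> orders the first two, \<open>s2\<close>
  places the third, and the final case split the fourth, each time by moving a false flag
  backwards.\<close>

lemma link_value_le:
  fixes a b c d q :: real
  assumes "0 \<le> a" "0 \<le> b" "0 \<le> c" "0 \<le> d" "0 \<le> q" "a + b + c + d + q = 1"
  shows "link_value a b c d q A B C D \<le> 12/125"
proof -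
  have s1: "link_value a b c d q A B C D \<le> 12/125"
    if "0 \<le> a" "0 \<le> b" "0 \<le> c" "0 \<le> d" "a + b + c + d + q = 1" "C \<longrightarrow> A" "C \<longrightarrow> B" "D \<longrightarrow> C" for a b c d A B C D
  proof (cases "B \<longrightarrow> A")
    case True
    then show ?thesis using that assms(5) by (intro link_value_sorted) auto
  next
    case False
    then have "link_value b a c d q B A C D \<le> 12/125"
      using that assms(5) by (intro link_value_sorted) auto
    then show ?thesis by (simp only: link_value_swap(1)[of a b])
  qed
  have s2: "link_value a b c d q A B C D \<le> 12/125"
    if "0 \<le> a" "0 \<le> b" "0 \<le> c" "0 \<le> d" "a + b + c + d + q = 1" "D \<longrightarrow> A" "D \<longrightarrow> B" "D \<longrightarrow> C" for a b c d A B C D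
  proof -
    consider "C \<longrightarrow> A \<and> B" | "\<not> B" | "\<not> A" by blast
    then show ?thesis
    proof cases
      case 1
      then show ?thesis using that by (intro s1) auto
    next
      case 2
      then have "link_value a c b d q A C B D \<le> 12/125" using that by (intro s1) auto
      then show ?thesis by (simp only: link_value_swap(2)[of a b])
    next
      case 3
      then have "link_value b c a d q B C A D \<le> 12/125" using that by (intro s1) auto
      then show ?thesis by (simp only: link_value_swap(1)[of a b] link_value_swap(2)[of b a])
    qed
  qed
  consider "D \<longrightarrow> A \<and> B \<and> C" | "\<not> C" | "\<not> B" | "\<not> A" by blast
  then show ?thesis
  proof cases
    case 1
    then show ?thesis using assms by (intro s2) auto
  next
    case 2
    then have "link_value a b d c q A B D C \<le> 12/125" using assms by (intro s2) auto
    then show ?thesis by (simp only: link_value_swap(3)[of a b c])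
  next
    case 3
    then have "link_value a c d b q A C D B \<le> 12/125" using assms by (intro s2) auto
    then show ?thesis by (simp only: link_value_swap(2)[of a b c] link_value_swap(3)[of a c b])
  next
    case 4
    then have "link_value b c d a q B C D A \<le> 12/125" using assms by (intro s2) auto
    then show ?thesis
      by (simp only: link_value_swap(1)[of a b c] link_value_swap(2)[of b a c] link_value_swap(3)[of b c a])
  qed
qed

section \<open>Lagrangians as trilinear sums\<close>

definition inc :: "nat set set \<Rightarrow> nat \<Rightarrow> nat \<Rightarrow> nat \<Rightarrow> real" where
  "inc E i j k = of_bool ({i,j,k} \<in> E)"

text \<open>Sums over ordered triples separate cleanly when the vertex set is partitioned. Triples
  with a repeated entry contribute nothing in a 3-graph.\<close>

definition tri :: "nat set set \<Rightarrow> (nat \<Rightarrow> real) \<Rightarrow> nat set \<Rightarrow> nat set \<Rightarrow> nat set \<Rightarrow> real" where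
  "tri E x A B C = (\<Sum>i\<in>A. \<Sum>j\<in>B. \<Sum>k\<in>C. x i * x j * x k * inc E i j k)"

lemma inc_swap: "inc E i j k = inc E j i k" "inc E i j k = inc E i k j"
  by (simp_all add: inc_def insert_commute)

lemma tri_swap12: "tri E x A B C = tri E x B A C"
  unfolding tri_def by (rule trans[OF sum.swap]) (simp add: mult_ac inc_def insert_commute)

lemma tri_swap23: "tri E x A B C = tri E x A C B"
  unfolding tri_def
  by (intro sum.cong refl trans[OF sum.swap]) (simp add: mult_ac inc_def insert_commute)

lemma tri_Un1:
  assumes "finite A" "finite A'" "A \<inter> A' = {}"
  shows "tri E x (A \<union> A') B C = tri E x A B C + tri E x A' B C"
  using assms by (simp add: tri_def sum.union_disjoint)

lemma tri_Un2:
  assumes "finite B" "finite B'" "B \<inter> B' = {}"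
  shows "tri E x A (B \<union> B') C = tri E x A B C + tri E x A B' C"
  using tri_Un1[OF assms] by (metis tri_swap12)

lemma tri_Un3:
  assumes "finite C" "finite C'" "C \<inter> C' = {}"
  shows "tri E x A B (C \<union> C') = tri E x A B C + tri E x A B C'"
  using tri_Un2[OF assms] by (metis tri_swap23)

lemma tri_cube_Un:
  assumes "finite A" "finite B" "A \<inter> B = {}"
  shows "tri E x (A \<union> B) (A \<union> B) (A \<union> B) =
    tri E x A A A + 3 * tri E x A A B + 3 * tri E x A B B + tri E x B B B"
proof -
  have "tri E x A B A = tri E x A A B" "tri E x B A A = tri E x A B A"
    "tri E x B A B = tri E x A B B" "tri E x B B A = tri E x B A B"
    by (rule tri_swap12 tri_swap23)+
  then show ?thesis
    unfolding tri_Un1[OF assms] tri_Un2[OF assms] tri_Un3[OF assms] by simp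
qed

lemma rgraph_finite: "is_rgraph r n E \<Longrightarrow> finite E"
  by (rule finite_subset[of _ "Pow {0..<n}"]) (auto simp: is_rgraph_def)

lemma triple_eq_iff:
  assumes "p \<noteq> q" "p \<noteq> r" "q \<noteq> r"
  shows "{i,j,k} = {p,q,r} \<longleftrightarrow> i = p \<and> j = q \<and> k = r \<or> i = p \<and> j = r \<and> k = q \<or> i = q \<and> j = p \<and> k = r
    \<or> i = q \<and> j = r \<and> k = p \<or> i = r \<and> j = p \<and> k = q \<or> i = r \<and> j = q \<and> k = p" (is "?L \<longleftrightarrow> ?R")
proof
  assume L: ?L
  then have "p = i \<or> p = j \<or> p = k" "q = i \<or> q = j \<or> q = k" "r = i \<or> r = j \<or> r = k" by blast+
  then show ?R using assms by metis
qed (auto simp: insert_commute)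

lemma of_bool_triple_eq:
  assumes "p \<noteq> q" "p \<noteq> r" "q \<noteq> r"
  shows "of_bool ({i,j,k} = {p,q,r}) =
    (of_bool (i = p) * of_bool (j = q) * of_bool (k = r) + of_bool (i = p) * of_bool (j = r) * of_bool (k = q)
     + of_bool (i = q) * of_bool (j = p) * of_bool (k = r) + of_bool (i = q) * of_bool (j = r) * of_bool (k = p)
     + of_bool (i = r) * of_bool (j = p) * of_bool (k = q) + of_bool (i = r) * of_bool (j = q) * of_bool (k = p) :: real)"
  unfolding triple_eq_iff[OF assms] using assms
  by (cases "i = p"; cases "i = q"; cases "i = r"; cases "j = p"; cases "j = q"; cases "j = r"; simp)

lemma sum_triple_delta:
  fixes x :: "nat \<Rightarrow> real"
  assumes "p \<in> V" "q \<in> V" "r \<in> V" "finite V"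
  shows "(\<Sum>i\<in>V. \<Sum>j\<in>V. \<Sum>k\<in>V. x i * x j * x k * (of_bool (i = p) * of_bool (j = q) * of_bool (k = r)))
    = x p * x q * x r"
proof -
  have 1: "(\<Sum>k\<in>V. x i * x j * x k * (of_bool (i = p) * of_bool (j = q) * of_bool (k = r)))
      = x i * x j * (of_bool (i = p) * of_bool (j = q)) * (\<Sum>k\<in>V. x k * of_bool (k = r))" for i j
    by (simp only: sum_distrib_left mult_ac)
  have 2: "(\<Sum>j\<in>V. x i * x j * (of_bool (i = p) * of_bool (j = q)))
      = x i * of_bool (i = p) * (\<Sum>j\<in>V. x j * of_bool (j = q))" for i
    by (simp only: sum_distrib_left sum_distrib_right mult_ac)
  have 3: "(\<Sum>k\<in>V. x k * of_bool (k = v)) = x v" if "v \<in> V" for v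
    using that \<open>finite V\<close> by (simp add: sum.remove[of V v])
  show ?thesis unfolding 1 3[OF assms(3)] sum_distrib_right[symmetric] 2 3[OF assms(2)] 3[OF assms(1)] by (rule refl)
qed

text \<open>Each edge is counted once for each of its six orderings.\<close>

lemma tri_eq_lam_poly:
  assumes "is_rgraph 3 n E"
  shows "tri E x {0..<n} {0..<n} {0..<n} = 6 * lam_poly E x"
proof -
  let ?V = "{0..<n}"
  have fin: "finite E" by (rule rgraph_finite[OF assms])
  have one: "(\<Sum>i\<in>?V. \<Sum>j\<in>?V. \<Sum>k\<in>?V. x i * x j * x k * of_bool ({i,j,k} = e)) = 6 * (\<Prod>i\<in>e. x i)"
    if "e \<in> E" for e
  proof -
    have "card e = 3" "e \<subseteq> ?V" using assms that by (auto simp: is_rgraph_def)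
    then obtain p q r where e: "e = {p,q,r}" and d: "p \<noteq> q" "p \<noteq> r" "q \<noteq> r"
      by (auto simp: card_3_iff)
    then have V: "p \<in> ?V" "q \<in> ?V" "r \<in> ?V" using \<open>e \<subseteq> ?V\<close> by auto
    show ?thesis
      unfolding e of_bool_triple_eq[OF d] distrib_left sum.distrib
      using V d by (simp only: sum_triple_delta finite_atLeastLessThan) simp
  qed
  have "inc E i j k = (\<Sum>e\<in>E. of_bool ({i,j,k} = e))" for i j k
    using fin by (simp add: inc_def)
  then have "tri E x ?V ?V ?V = (\<Sum>i\<in>?V. \<Sum>j\<in>?V. \<Sum>k\<in>?V. \<Sum>e\<in>E. x i * x j * x k * of_bool ({i,j,k} = e))"
    by (simp only: tri_def sum_distrib_left)
  also have "\<dots> = (\<Sum>e\<in>E. \<Sum>i\<in>?V. \<Sum>j\<in>?V. \<Sum>k\<in>?V. x i * x j * x k * of_bool ({i,j,k} = e))"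
  proof -
    have "(\<Sum>i\<in>?V. \<Sum>j\<in>?V. \<Sum>k\<in>?V. \<Sum>e\<in>E. h i j k e) = (\<Sum>e\<in>E. \<Sum>i\<in>?V. \<Sum>j\<in>?V. \<Sum>k\<in>?V. h i j k e)"
      for h :: "nat \<Rightarrow> nat \<Rightarrow> nat \<Rightarrow> nat set \<Rightarrow> real"
    proof -
      have "(\<Sum>k\<in>?V. \<Sum>e\<in>E. h i j k e) = (\<Sum>e\<in>E. \<Sum>k\<in>?V. h i j k e)" for i j
        by (rule sum.swap)
      moreover have "(\<Sum>j\<in>?V. \<Sum>e\<in>E. \<Sum>k\<in>?V. h i j k e) = (\<Sum>e\<in>E. \<Sum>j\<in>?V. \<Sum>k\<in>?V. h i j k e)" for i
        by (rule sum.swap)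
      moreover have "(\<Sum>i\<in>?V. \<Sum>e\<in>E. \<Sum>j\<in>?V. \<Sum>k\<in>?V. h i j k e) = (\<Sum>e\<in>E. \<Sum>i\<in>?V. \<Sum>j\<in>?V. \<Sum>k\<in>?V. h i j k e)"
        by (rule sum.swap)
      ultimately show ?thesis by simp
    qed
    then show ?thesis .
  qed
  also have "\<dots> = 6 * lam_poly E x"
    by (simp only: one lam_poly_def sum_distrib_left cong: sum.cong)
  finally show ?thesis .
qed

section \<open>Graphs without a complete graph on four vertices\<close>

text \<open>
  In the flag algebra proof three of the five vertices serve as the root, and a further vertex is described by which
  of the three pairs of root vertices it forms an edge with. The squares are those of two functions of the number of
  these pairs (the root not being an edge) and of a vector of mean zero (the root being an edge); the weights are a rounded
  solution of the semidefinite program.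
\<close>

fun count_weight :: "'a \<Rightarrow> 'a \<Rightarrow> 'a \<Rightarrow> 'a \<Rightarrow> bool \<Rightarrow> bool \<Rightarrow> bool \<Rightarrow> 'a" where
  "count_weight w0 w1 w2 w3 p q r =
    (if p then if q then if r then w3 else w2 else if r then w2 else w1
     else if q then if r then w2 else w1 else if r then w1 else w0)"

text \<open>The three cyclic rotations of the arguments give the coordinates of the mean zero
  vector.\<close>

fun dev :: "bool \<Rightarrow> bool \<Rightarrow> bool \<Rightarrow> int" where
  "dev p q r = (if p then if q then if r then 0 else 3 else if r then 3 else 8
     else if q then if r then - 6 else - 4 else if r then - 4 else 0)"

text \<open>\<open>t\<close> records whether the root is an edge, the two groups of flags describe
  the two further vertices. Densities are scaled by 100000; the factor 577 makes the edgeless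
  configuration attain the total 577000 exactly.\<close>

definition root_term :: "bool \<Rightarrow> bool \<Rightarrow> bool \<Rightarrow> bool \<Rightarrow> bool \<Rightarrow> bool \<Rightarrow> bool \<Rightarrow> int" where
  "root_term t p q r p' q' r' =
    (if t then 100000 + 640 * (dev p q r * dev p' q' r' + dev q r p * dev q' r' p' + dev r p q * dev r' p' q')
     else 577 * (count_weight 10 5 1 (-10) p q r * count_weight 10 5 1 (-10) p' q' r')
        + 1800 * (count_weight 0 5 (-5) 4 p q r * count_weight 0 5 (-5) 4 p' q' r'))"

definition root_check where
  "root_check e123 e124 e125 e134 e135 e145 e234 e235 e245 e345 \<longleftrightarrow>
    (e123 \<and> e124 \<and> e134 \<and> e234) \<or> (e123 \<and> e125 \<and> e135 \<and> e235) \<or> (e124 \<and> e125 \<and> e145 \<and> e245)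
    \<or> (e134 \<and> e135 \<and> e145 \<and> e345) \<or> (e234 \<and> e235 \<and> e245 \<and> e345)
    \<or> root_term e123 e124 e134 e234 e125 e135 e235
     + root_term e124 e123 e134 e234 e125 e145 e245
     + root_term e125 e123 e135 e235 e124 e145 e245
     + root_term e134 e123 e124 e234 e135 e145 e345
     + root_term e135 e123 e125 e235 e134 e145 e345
     + root_term e145 e124 e125 e245 e134 e135 e345
     + root_term e234 e123 e124 e134 e235 e245 e345
     + root_term e235 e123 e125 e135 e234 e245 e345
     + root_term e245 e124 e125 e145 e234 e235 e345
     + root_term e345 e134 e135 e145 e234 e235 e245 \<le> 577000"

text \<open>A finite evaluation over the 1024 graphs on five vertices: each contains a
  \<open>K4\<close> or has total at most 577000, which is 577/1000 scaled by 100000 and by the ten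
  roots.\<close>

lemma root_check_all: "\<forall>e123 e124 e125 e134 e135 e145 e234 e235 e245 e345. root_check e123 e124 e125 e134 e135 e145 e234 e235 e245 e345"
  by code_simp

lemma root_sum_le:
  assumes "\<not> (e123 \<and> e124 \<and> e134 \<and> e234)" "\<not> (e123 \<and> e125 \<and> e135 \<and> e235)" "\<not> (e124 \<and> e125 \<and> e145 \<and> e245)"
    "\<not> (e134 \<and> e135 \<and> e145 \<and> e345)" "\<not> (e234 \<and> e235 \<and> e245 \<and> e345)"
  shows "root_term e123 e124 e134 e234 e125 e135 e235
     + root_term e124 e123 e134 e234 e125 e145 e245
     + root_term e125 e123 e135 e235 e124 e145 e245
     + root_term e134 e123 e124 e234 e135 e145 e345
     + root_term e135 e123 e125 e235 e134 e145 e345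
     + root_term e145 e124 e125 e245 e134 e135 e345
     + root_term e234 e123 e124 e134 e235 e245 e345
     + root_term e235 e123 e125 e135 e234 e245 e345
     + root_term e245 e124 e125 e145 e234 e235 e345
     + root_term e345 e134 e135 e145 e234 e235 e245 \<le> 577000"
  using root_check_all[rule_format, of e123 e124 e125 e134 e135 e145 e234 e235 e245 e345]
  unfolding root_check_def
  by (elim disjE) (simp_all only: assms simp_thms)

section \<open>Averages over five sampled vertices\<close>

definition quint :: "nat set \<Rightarrow> (nat \<Rightarrow> real) \<Rightarrow> (nat \<Rightarrow> nat \<Rightarrow> nat \<Rightarrow> nat \<Rightarrow> nat \<Rightarrow> real) \<Rightarrow> real" where
  "quint V x F = (\<Sum>i\<in>V. \<Sum>j\<in>V. \<Sum>k\<in>V. \<Sum>u\<in>V. \<Sum>v\<in>V. x i * x j * x k * x u * x v * F i j k u v)"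

lemma quint_swap12: "quint V x F = quint V x (\<lambda>i j k u v. F j i k u v)"
  unfolding quint_def by (rule trans[OF sum.swap]) (simp add: mult_ac)

lemma quint_swap23: "quint V x F = quint V x (\<lambda>i j k u v. F i k j u v)"
  unfolding quint_def by (rule sum.cong[OF refl], rule trans[OF sum.swap]) (simp add: mult_ac)

lemma quint_swap34: "quint V x F = quint V x (\<lambda>i j k u v. F i j u k v)"
  unfolding quint_def by (rule sum.cong[OF refl], rule sum.cong[OF refl], rule trans[OF sum.swap]) (simp add: mult_ac)

lemma quint_swap45: "quint V x F = quint V x (\<lambda>i j k u v. F i j k v u)"
  unfolding quint_def by (rule sum.cong[OF refl], rule sum.cong[OF refl], rule sum.cong[OF refl], rule trans[OF sum.swap]) (simp add: mult_ac)

lemma quint_add: "quint V x (\<lambda>i j k u v. F i j k u v + G i j k u v) = quint V x F + quint V x G"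
  by (simp add: quint_def distrib_left sum.distrib)

lemma quint_const:
  assumes "(\<Sum>i\<in>V. x i) = 1"
  shows "quint V x (\<lambda>i j k u v. c) = c"
  unfolding quint_def using assms by (simp flip: sum_distrib_left sum_distrib_right)

lemma quint_mono:
  assumes "\<And>i. i \<in> V \<Longrightarrow> 0 \<le> x i" and "\<And>i j k u v. F i j k u v \<le> G i j k u v"
  shows "quint V x F \<le> quint V x G"
  unfolding quint_def using assms by (intro sum_mono mult_left_mono) auto

text \<open>Relabelling the sampled vertices leaves the sum unchanged, so all ten choices of a root
  triple agree; adjacent transpositions lead from one to the next.\<close>

lemma quint_ten_roots:
  "10 * quint V x F = quint V x (\<lambda>i j k u v.
    F i j k u v + F i j u k v + F i j v k u + F i k u j v + F i k v j u + F i u v j k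
    + F j k u i v + F j k v i u + F j u v i k + F k u v i j)"
proof -
  have "quint V x F = quint V x (\<lambda>i j k u v. F i j u k v)"
    by (rule quint_swap34)
  moreover have "\<dots> = quint V x (\<lambda>i j k u v. F i j v k u)"
    by (rule quint_swap45)
  moreover have "quint V x (\<lambda>i j k u v. F i j u k v) = quint V x (\<lambda>i j k u v. F i k u j v)"
    by (rule quint_swap23)
  moreover have "\<dots> = quint V x (\<lambda>i j k u v. F i k v j u)"
    by (rule quint_swap45)
  moreover have "\<dots> = quint V x (\<lambda>i j k u v. F i u v j k)"
    by (rule quint_swap34)
  moreover have "quint V x (\<lambda>i j k u v. F i k u j v) = quint V x (\<lambda>i j k u v. F j k u i v)"
    by (rule quint_swap12)
  moreover have "quint V x (\<lambda>i j k u v. F i k v j u) = quint V x (\<lambda>i j k u v. F j k v i u)"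
    by (rule quint_swap12)
  moreover have "quint V x (\<lambda>i j k u v. F i u v j k) = quint V x (\<lambda>i j k u v. F j u v i k)"
    by (rule quint_swap12)
  moreover have "\<dots> = quint V x (\<lambda>i j k u v. F k u v i j)"
    by (rule quint_swap23)
  ultimately show ?thesis by (simp add: quint_add)
qed

lemma sum_sum_square:
  fixes x f :: "nat \<Rightarrow> real"
  shows "(\<Sum>u\<in>V. \<Sum>v\<in>V. x u * x v * (c * (f u * f v))) = c * (\<Sum>u\<in>V. x u * f u)\<^sup>2"
  by (simp add: power2_eq_square sum_product sum_distrib_left mult_ac)

text \<open>With the root fixed, \<open>u\<close> and \<open>v\<close> are sampled independently, so
  every product of flag functions averages to a square and only nonnegative terms are added to the
  edge indicator.\<close>

lemma root_term_average:
  fixes x :: "nat \<Rightarrow> real"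
  assumes "(\<Sum>i\<in>V. x i) = 1"
  shows "100000 * of_bool t \<le> (\<Sum>u\<in>V. \<Sum>v\<in>V. x u * x v * real_of_int (root_term t (f u) (g u) (h u) (f v) (g v) (h v)))"
proof (cases t)
  case True
  have "(\<Sum>u\<in>V. \<Sum>v\<in>V. x u * x v * real_of_int (root_term t (f u) (g u) (h u) (f v) (g v) (h v)))
      = 100000 * (\<Sum>u\<in>V. x u * 1)\<^sup>2 + 640 * (\<Sum>u\<in>V. x u * dev (f u) (g u) (h u))\<^sup>2
        + 640 * (\<Sum>u\<in>V. x u * dev (g u) (h u) (f u))\<^sup>2 + 640 * (\<Sum>u\<in>V. x u * dev (h u) (f u) (g u))\<^sup>2"
    unfolding sum_sum_square[symmetric] sum.distrib[symmetric]
    using True by (simp add: root_term_def algebra_simps del: dev.simps)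
  then show ?thesis using assms True by simp
next
  case False
  have "(\<Sum>u\<in>V. \<Sum>v\<in>V. x u * x v * real_of_int (root_term t (f u) (g u) (h u) (f v) (g v) (h v)))
      = 577 * (\<Sum>u\<in>V. x u * real_of_int (count_weight 10 5 1 (-10) (f u) (g u) (h u)))\<^sup>2
        + 1800 * (\<Sum>u\<in>V. x u * real_of_int (count_weight 0 5 (-5) 4 (f u) (g u) (h u)))\<^sup>2"
    unfolding sum_sum_square[symmetric] sum.distrib[symmetric]
    using False by (simp add: root_term_def algebra_simps del: count_weight.simps)
  then show ?thesis using False by simp
qed

text \<open>The root terms dominate the edge indicator on average, and the five-vertex check bounds
  their total pointwise. Freeness is assumed for all quadruples, also with coincidences, since the
  sampled vertices may repeat.\<close>

lemma K4_free_tri_le: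
  assumes pos: "\<And>i. i \<in> V \<Longrightarrow> 0 \<le> x i" and one: "(\<Sum>i\<in>V. x i) = 1"
    and free: "\<And>a b c d. \<not> ({a,b,c} \<in> E \<and> {a,b,d} \<in> E \<and> {a,c,d} \<in> E \<and> {b,c,d} \<in> E)"
  shows "tri E x V V V \<le> 577/1000"
proof -
  define t where "t i j k \<longleftrightarrow> {i,j,k} \<in> E" for i j k
  define F where "F i j k u v = real_of_int (root_term (t i j k) (t i j u) (t i k u) (t j k u) (t i j v) (t i k v) (t j k v))"
    for i j k u v
  have "tri E x V V V * 100000 = (\<Sum>i\<in>V. \<Sum>j\<in>V. \<Sum>k\<in>V. x i * x j * x k * (100000 * of_bool (t i j k)))"
    by (simp add: tri_def inc_def t_def sum_distrib_left sum_distrib_right mult_ac)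
  also have "\<dots> \<le> (\<Sum>i\<in>V. \<Sum>j\<in>V. \<Sum>k\<in>V. x i * x j * x k * (\<Sum>u\<in>V. \<Sum>v\<in>V. x u * x v * F i j k u v))"
    unfolding F_def using pos by (intro sum_mono mult_left_mono root_term_average[OF one]) auto
  also have "\<dots> = quint V x F"
    by (simp add: quint_def sum_distrib_left mult_ac)
  finally have 1: "tri E x V V V * 100000 \<le> quint V x F" .
  have sym: "t j i k = t i j k" "t i k j = t i j k" for i j k
    by (simp_all add: t_def insert_commute)
  have "F i j k u v + F i j u k v + F i j v k u + F i k u j v + F i k v j u + F i u v j k
    + F j k u i v + F j k v i u + F j u v i k + F k u v i j \<le> 577000" (is "?s \<le> _") for i j k u v
  proof -
    have s1: "t i u k = t i k u" "t j u k = t j k u" "t i v k = t i k v" "t j v k = t j k v" "t i v u = t i u v" "t j v u = t j u v"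
      "t i k j = t i j k" "t i u j = t i j u" "t i v j = t i j v" "t k u j = t j k u" "t k v j = t j k v" "t u v j = t j u v"
      "t k v u = t k u v" "t u v k = t k u v"
      "t j k i = t i j k" "t j u i = t i j u" "t j v i = t i j v" "t k u i = t i k u" "t k v i = t i k v" "t u v i = t i u v"
      by (simp_all add: t_def insert_commute)
    have "\<not> (t i j k \<and> t i j u \<and> t i k u \<and> t j k u)" "\<not> (t i j k \<and> t i j v \<and> t i k v \<and> t j k v)"
       "\<not> (t i j u \<and> t i j v \<and> t i u v \<and> t j u v)" "\<not> (t i k u \<and> t i k v \<and> t i u v \<and> t k u v)"
       "\<not> (t j k u \<and> t j k v \<and> t j u v \<and> t k u v)"
      unfolding t_def by (rule free)+
    from root_sum_le[OF this] have "real_of_int (root_term (t i j k) (t i j u) (t i k u) (t j k u) (t i j v) (t i k v) (t j k v)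
     + root_term (t i j u) (t i j k) (t i k u) (t j k u) (t i j v) (t i u v) (t j u v)
     + root_term (t i j v) (t i j k) (t i k v) (t j k v) (t i j u) (t i u v) (t j u v)
     + root_term (t i k u) (t i j k) (t i j u) (t j k u) (t i k v) (t i u v) (t k u v)
     + root_term (t i k v) (t i j k) (t i j v) (t j k v) (t i k u) (t i u v) (t k u v)
     + root_term (t i u v) (t i j u) (t i j v) (t j u v) (t i k u) (t i k v) (t k u v)
     + root_term (t j k u) (t i j k) (t i j u) (t i k u) (t j k v) (t j u v) (t k u v)
     + root_term (t j k v) (t i j k) (t i j v) (t i k v) (t j k u) (t j u v) (t k u v)
     + root_term (t j u v) (t i j u) (t i j v) (t i u v) (t j k u) (t j k v) (t k u v)
     + root_term (t k u v) (t i k u) (t i k v) (t i u v) (t j k u) (t j k v) (t j u v)) \<le> real_of_int 577000"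
      by (simp only: of_int_le_iff)
    then show ?thesis unfolding F_def s1 by simp
  qed
  note ten = this
  have "quint V x (\<lambda>i j k u v.
      F i j k u v + F i j u k v + F i j v k u + F i k u j v + F i k v j u + F i u v j k
      + F j k u i v + F j k v i u + F j u v i k + F k u v i j) \<le> quint V x (\<lambda>i j k u v. 577000)"
    by (rule quint_mono[OF pos ten])
  then have "10 * quint V x F \<le> 577000"
    unfolding quint_ten_roots quint_const[OF one] .
  with 1 show ?thesis by linarith
qed

section \<open>Graphs with a complete graph on four vertices\<close>

definition K4 :: "nat set set \<Rightarrow> nat \<Rightarrow> nat \<Rightarrow> nat \<Rightarrow> nat \<Rightarrow> bool" where
  "K4 E a b c d \<longleftrightarrow> {a,b,c} \<in> E \<and> {a,b,d} \<in> E \<and> {a,c,d} \<in> E \<and> {b,c,d} \<in> E"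

lemma K4_swap: "K4 E a b c d = K4 E b a c d" "K4 E a b c d = K4 E a b d c"
  by (auto simp: K4_def insert_commute)

lemma K4_pairs:
  assumes "K4 E a b c d"
  shows "K4 E a c b d" "K4 E a d b c" "K4 E b c a d" "K4 E b d a c" "K4 E c d a b"
        "K4 E b a c d" "K4 E c a b d" "K4 E d a b c" "K4 E c b a d" "K4 E d b a c" "K4 E d c a b"
  using assms unfolding K4_def by (simp_all add: insert_commute)

lemma inc_bounds: "0 \<le> inc E i j k" "inc E i j k \<le> 1"
  by (simp_all add: inc_def)

lemma inc_degenerate:
  assumes "is_rgraph 3 n E"
  shows "inc E i i j = 0" "inc E i j i = 0" "inc E j i i = 0"
proof -
  have "{i,j} \<notin> E"
  proof
    assume "{i,j} \<in> E"
    then have "card {i,j} = 3" using assms unfolding is_rgraph_def by blast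
    then show False by (simp add: card_insert_if split: if_splits)
  qed
  then show "inc E i i j = 0" "inc E i j i = 0" "inc E j i i = 0"
    by (simp_all add: inc_def insert_commute)
qed

lemma K4_distinct:
  assumes "is_rgraph 3 n E" "K4 E a b c d"
  shows "a \<noteq> b" "a \<noteq> c" "a \<noteq> d" "b \<noteq> c" "b \<noteq> d" "c \<noteq> d"
  using assms inc_degenerate[OF assms(1)] by (auto simp: K4_def inc_def insert_commute)

lemma K4_subset:
  assumes "is_rgraph 3 n E" "K4 E a b c d"
  shows "{a,b,c,d} \<subseteq> {0..<n}"
  using assms by (auto simp: is_rgraph_def K4_def)

lemma tri_eq_0:
  assumes "\<And>i j k. i \<in> A \<Longrightarrow> j \<in> B \<Longrightarrow> k \<in> C \<Longrightarrow> {i,j,k} \<notin> E"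
  shows "tri E x A B C = 0"
  using assms by (simp add: tri_def inc_def)

lemma tri_le:
  assumes "\<And>i. i \<in> A \<union> B \<union> C \<Longrightarrow> 0 \<le> x i"
  shows "tri E x A B C \<le> sum x A * sum x B * sum x C"
proof -
  have "tri E x A B C \<le> (\<Sum>i\<in>A. \<Sum>j\<in>B. \<Sum>k\<in>C. x i * x j * x k * 1)"
    unfolding tri_def using assms inc_bounds by (intro sum_mono mult_left_mono) auto
  also have "\<dots> = sum x A * sum x B * sum x C"
    by (simp flip: sum_distrib_left sum_distrib_right)
  finally show ?thesis .
qed

section \<open>Weighted free graphs, and the case without a second \<open>K4\<close> sharing exactly
  a pair\<close>

locale K4_edge_free =
  fixes n :: nat and E :: "nat set set" and x :: "nat \<Rightarrow> real"
  assumes rgraph: "is_rgraph 3 n E"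
    and nonneg: "i < n \<Longrightarrow> 0 \<le> x i"
    and total: "sum x {0..<n} = 1"
    and meets: "K4 E a b c d \<Longrightarrow> e \<in> E \<Longrightarrow> e \<inter> {a,b,c,d} \<noteq> {}"
begin

abbreviation V where "V \<equiv> {0..<n}"

text \<open>No edge lies in \<open>S\<close>, so the polynomial is the average of
  \<open>\<Phi> u v\<close> over two vertices of \<open>S\<close>. Each value is at most a
  \<open>link_value\<close>; ordered triples turn 12/125 into 72/125.\<close>

lemma spread_bound:
  assumes T: "K4 E a b c d"
    and spread: "\<And>s t u v. {s,t} \<subseteq> {a,b,c,d} \<Longrightarrow> s \<noteq> t \<Longrightarrow> u \<notin> {a,b,c,d} \<Longrightarrow> v \<notin> {a,b,c,d} \<Longrightarrow> \<not> K4 E s t u v"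
  shows "tri E x V V V \<le> 72/125"
proof -
  let ?T = "{a,b,c,d}"
  define S where "S = V - ?T"
  define q where "q = sum x S"
  define h where "h u = x a * x b * inc E a b u + x a * x c * inc E a c u + x a * x d * inc E a d u
    + x b * x c * inc E b c u + x b * x d * inc E b d u + x c * x d * inc E c d u" for u
  define l where "l u v = x a * inc E a u v + x b * inc E b u v + x c * inc E c u v + x d * inc E d u v" for u v
  define e3 where "e3 = x a * x b * x c + x a * x b * x d + x a * x c * x d + x b * x c * x d"
  define H where "H = (\<Sum>u\<in>S. x u * h u)"
  define L where "L = (\<Sum>u\<in>S. \<Sum>v\<in>S. x u * x v * l u v)"
  note dist = K4_distinct[OF rgraph T]
  have TV: "?T \<subseteq> V" by (rule K4_subset[OF rgraph T])
  then have V: "V = ?T \<union> S" and fin: "finite S" and disj: "?T \<inter> S = {}" by (auto simp: S_def)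
  have pos: "0 \<le> x a" "0 \<le> x b" "0 \<le> x c" "0 \<le> x d" using TV nonneg by auto
  have posS: "0 \<le> x u" if "u \<in> S" for u using that nonneg by (auto simp: S_def)
  have q0: "0 \<le> q" unfolding q_def using posS by (intro sum_nonneg)
  have sum1: "x a + x b + x c + x d + q = 1"
  proof -
    have "sum x V = sum x ?T + sum x S"
      unfolding V by (rule sum.union_disjoint[OF _ fin disj]) simp
    then show ?thesis using total dist by (simp add: q_def)
  qed
  note deg = inc_degenerate[OF rgraph]
  have inc1: "inc E a b c = 1" "inc E a c b = 1" "inc E b a c = 1" "inc E b c a = 1" "inc E c a b = 1" "inc E c b a = 1"
    "inc E a b d = 1" "inc E a d b = 1" "inc E b a d = 1" "inc E b d a = 1" "inc E d a b = 1" "inc E d b a = 1"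
    "inc E a c d = 1" "inc E a d c = 1" "inc E c a d = 1" "inc E c d a = 1" "inc E d a c = 1" "inc E d c a = 1"
    "inc E b c d = 1" "inc E b d c = 1" "inc E c b d = 1" "inc E c d b = 1" "inc E d b c = 1" "inc E d c b = 1"
    using T by (auto simp: K4_def inc_def insert_commute)
  have TTT: "tri E x ?T ?T ?T = 6 * e3"
    using dist by (simp add: tri_def deg inc1 e3_def algebra_simps)
  have TTS: "tri E x ?T ?T S = 2 * H"
  proof -
    have "tri E x ?T ?T S = tri E x S ?T ?T" by (metis tri_swap12 tri_swap23)
    also have "\<dots> = (\<Sum>u\<in>S. x u * (2 * h u))"
      unfolding tri_def
    proof (rule sum.cong[OF refl])
      fix u
      have perm: "inc E u b a = inc E a b u" "inc E u a b = inc E a b u" "inc E u a c = inc E a c u" "inc E u c a = inc E a c u"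
        "inc E u a d = inc E a d u" "inc E u d a = inc E a d u" "inc E u b c = inc E b c u" "inc E u c b = inc E b c u"
        "inc E u b d = inc E b d u" "inc E u d b = inc E b d u" "inc E u c d = inc E c d u" "inc E u d c = inc E c d u"
        by (simp_all add: inc_def insert_commute)
      show "(\<Sum>j\<in>?T. \<Sum>k\<in>?T. x u * x j * x k * inc E u j k) = x u * (2 * h u)"
        using dist by (simp add: deg perm h_def algebra_simps)
    qed
    finally show ?thesis by (simp add: H_def sum_distrib_left mult_ac)
  qed
  have TSS: "tri E x ?T S S = L"
  proof -
    have "tri E x ?T S S = tri E x S S ?T" by (metis tri_swap12 tri_swap23)
    also have "\<dots> = L"
      unfolding tri_def L_def
    proof (intro sum.cong refl)
      fix u v
      have perm: "inc E u v t = inc E t u v" for t by (simp add: inc_def insert_commute)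
      show "(\<Sum>k\<in>?T. x u * x v * x k * inc E u v k) = x u * x v * l u v"
        using dist by (simp add: perm l_def algebra_simps)
    qed
    finally show ?thesis .
  qed
  have SSS: "tri E x S S S = 0"
    using meets[OF T] by (intro tri_eq_0) (force simp: S_def)
  have tri: "tri E x V V V = 6 * (e3 + H + L/2)"
    unfolding V using tri_cube_Un[OF _ fin disj] TTT TTS TSS SSS by simp
  define \<Phi> where "\<Phi> u v = e3 + q/2 * (h u + h v) + q^2/2 * l u v" for u v
  have pointwise: "\<Phi> u v \<le> 12/125" if uv: "u \<in> S" "v \<in> S" for u v
  proof -
    \<comment> \<open>If \<open>{s,u,v}\<close> and \<open>{t,u,v}\<close> are both edges, the
      absence of a \<open>K4\<close> on \<open>s, t, u, v\<close> forces \<open>{s,t,u}\<close> or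
      \<open>{s,t,v}\<close> to be missing.\<close>
    have inc2: "inc E s t u + inc E s t v \<le> 2 - of_bool ({s,u,v} \<in> E \<and> {t,u,v} \<in> E)"
      if "{s,t} \<subseteq> ?T" "s \<noteq> t" for s t
    proof -
      have "\<not> K4 E s t u v" using spread[OF that] uv by (auto simp: S_def)
      then show ?thesis by (auto simp: K4_def inc_def)
    qed
    have "x s * x t * inc E s t u + x s * x t * inc E s t v
        \<le> 2 * (x s * x t) - x s * x t * of_bool ({s,u,v} \<in> E \<and> {t,u,v} \<in> E)"
      if "{s,t} \<subseteq> ?T" "s \<noteq> t" for s t
    proof -
      have "0 \<le> x s * x t" using that pos by auto
      from mult_left_mono[OF inc2[OF that] this] show ?thesis by (simp add: algebra_simps)
    qed
    from this[of a b] this[of a c] this[of a d] this[of b c] this[of b d] this[of c d]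
    have "h u + h v \<le> 2 * (x a * x b + x a * x c + x a * x d + x b * x c + x b * x d + x c * x d)
      - (x a * x b * of_bool ({a,u,v} \<in> E \<and> {b,u,v} \<in> E) + x a * x c * of_bool ({a,u,v} \<in> E \<and> {c,u,v} \<in> E)
        + x a * x d * of_bool ({a,u,v} \<in> E \<and> {d,u,v} \<in> E) + x b * x c * of_bool ({b,u,v} \<in> E \<and> {c,u,v} \<in> E)
        + x b * x d * of_bool ({b,u,v} \<in> E \<and> {d,u,v} \<in> E) + x c * x d * of_bool ({c,u,v} \<in> E \<and> {d,u,v} \<in> E))"
      (is "_ \<le> ?R") using dist unfolding h_def by simp
    then have "q/2 * (h u + h v) \<le> q/2 * ?R"
      using q0 by (intro mult_left_mono) auto
    then have "\<Phi> u v \<le> link_value (x a) (x b) (x c) (x d) q ({a,u,v} \<in> E) ({b,u,v} \<in> E) ({c,u,v} \<in> E) ({d,u,v} \<in> E)"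
      unfolding \<Phi>_def link_value_def e3_def l_def inc_def by (simp add: algebra_simps)
    also have "\<dots> \<le> 12/125" using pos q0 sum1 by (intro link_value_le) auto
    finally show ?thesis .
  qed
  show ?thesis
  \<comment> \<open>Averaging divides by \<open>q^2\<close>; at outside weight zero only the triples
    inside \<open>T\<close> remain.\<close>
  proof (cases "q = 0")
    case True
    then have "x u = 0" if "u \<in> S" for u
      using that sum_nonneg_eq_0_iff[OF fin] posS unfolding q_def by blast
    then have "H = 0" "L = 0" by (simp_all add: H_def L_def)
    moreover have "e3 \<le> 12/125"
      using esym4_bounds(2)[OF pos] sum1 True by (simp add: e3_def)
    ultimately show ?thesis by (simp add: tri)
  next
    case False
    have const: "(\<Sum>u\<in>S. \<Sum>v\<in>S. x u * x v * k) = q^2 * k" for k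
      by (simp add: q_def power2_eq_square flip: sum_distrib_left sum_distrib_right)
    have "(\<Sum>u\<in>S. \<Sum>v\<in>S. x u * x v * \<Phi> u v) \<le> (\<Sum>u\<in>S. \<Sum>v\<in>S. x u * x v * (12/125))"
      using pointwise posS by (intro sum_mono mult_left_mono) auto
    also have "\<dots> = q^2 * (12/125)"
      by (rule const)
    also have "(\<Sum>u\<in>S. \<Sum>v\<in>S. x u * x v * \<Phi> u v) = q^2 * (e3 + H + L/2)"
    proof -
      note 1 = const[of e3]
      have 2: "(\<Sum>u\<in>S. \<Sum>v\<in>S. x u * x v * (q/2 * h u)) = q^2/2 * H"
      proof -
        have "(\<Sum>u\<in>S. \<Sum>v\<in>S. x u * x v * (q/2 * h u)) = q/2 * ((\<Sum>u\<in>S. x u * h u) * (\<Sum>v\<in>S. x v))"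
          unfolding sum_product by (simp add: sum_distrib_left mult_ac)
        then show ?thesis by (simp add: H_def q_def power2_eq_square)
      qed
      have 3: "(\<Sum>u\<in>S. \<Sum>v\<in>S. x u * x v * (q/2 * h v)) = q^2/2 * H"
        using 2 by (subst sum.swap) (simp add: mult_ac)
      have 4: "(\<Sum>u\<in>S. \<Sum>v\<in>S. x u * x v * (q^2/2 * l u v)) = q^2/2 * L"
        by (simp add: L_def sum_distrib_left mult_ac)
      have "(\<Sum>u\<in>S. \<Sum>v\<in>S. x u * x v * \<Phi> u v) = (\<Sum>u\<in>S. \<Sum>v\<in>S. x u * x v * e3 + x u * x v * (q/2 * h u)
          + x u * x v * (q/2 * h v) + x u * x v * (q^2/2 * l u v))"
        by (intro sum.cong refl) (simp add: \<Phi>_def algebra_simps add_divide_distrib)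
      also have "\<dots> = q^2 * e3 + q^2/2 * H + q^2/2 * H + q^2/2 * L"
        by (simp only: sum.distrib 1 2 3 4)
      finally show ?thesis by (simp add: algebra_simps)
    qed
    finally have "e3 + H + L/2 \<le> 12/125" using False by simp
    then show ?thesis by (simp add: tri)
  qed
qed

section \<open>Sorting the edges by their intersection with a pair\<close>

definition outer where "outer a b = V - {a,b}"

definition pair_degree where
  "pair_degree a b = (\<Sum>y\<in>outer a b. x y * inc E a b y)"

definition link_sum where
  "link_sum a b = (\<Sum>y\<in>outer a b. \<Sum>w\<in>outer a b. x y * x w * (x a * inc E a y w + x b * inc E b y w))"

lemma finite_outer [simp]: "finite (outer a b)"
  by (simp add: outer_def)

lemma outer_nonneg: "y \<in> outer a b \<Longrightarrow> 0 \<le> x y"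
  using nonneg by (simp add: outer_def)

lemma sum_outer:
  assumes "a < n" "b < n" "a \<noteq> b"
  shows "x a + x b + sum x (outer a b) = 1"
proof -
  have V: "V = {a,b} \<union> outer a b" using assms by (auto simp: outer_def)
  have "sum x V = sum x {a,b} + sum x (outer a b)"
    unfolding V by (rule sum.union_disjoint) (auto simp: outer_def)
  then show ?thesis using total assms by simp
qed

text \<open>The three summands belong to the edges with two, one and no vertices in
  \<open>{a,b}\<close>; the factors count orderings.\<close>

lemma tri_split_pair:
  assumes "a < n" "b < n" "a \<noteq> b"
  shows "tri E x V V V = 6 * (x a * x b * pair_degree a b) + 3 * link_sum a b
    + tri E x (outer a b) (outer a b) (outer a b)"
proof -
  let ?P = "{a,b}" and ?Z = "outer a b"
  note deg = inc_degenerate[OF rgraph]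
  have V: "V = ?P \<union> ?Z" and disj: "?P \<inter> ?Z = {}" using assms by (auto simp: outer_def)
  have "tri E x ?P ?P ?P = 0"
    using assms by (simp add: tri_def deg)
  moreover have "tri E x ?P ?P ?Z = 2 * (x a * x b * pair_degree a b)"
  proof -
    have "tri E x ?P ?P ?Z = tri E x ?Z ?P ?P" by (metis tri_swap12 tri_swap23)
    also have "\<dots> = (\<Sum>y\<in>?Z. x y * (2 * (x a * x b * inc E a b y)))"
      unfolding tri_def
    proof (rule sum.cong[OF refl])
      fix y
      have "inc E y a b = inc E a b y" "inc E y b a = inc E a b y"
        by (simp_all add: inc_def insert_commute)
      then show "(\<Sum>j\<in>?P. \<Sum>k\<in>?P. x y * x j * x k * inc E y j k) = x y * (2 * (x a * x b * inc E a b y))"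
        using assms by (simp add: deg algebra_simps)
    qed
    finally show ?thesis by (simp add: pair_degree_def sum_distrib_left mult_ac)
  qed
  moreover have "tri E x ?P ?Z ?Z = link_sum a b"
  proof -
    have "tri E x ?P ?Z ?Z = tri E x ?Z ?Z ?P" by (metis tri_swap12 tri_swap23)
    also have "\<dots> = link_sum a b"
      unfolding tri_def link_sum_def
    proof (intro sum.cong refl)
      fix y w
      have "inc E y w t = inc E t y w" for t by (simp add: inc_def insert_commute)
      then show "(\<Sum>k\<in>?P. x y * x w * x k * inc E y w k) = x y * x w * (x a * inc E a y w + x b * inc E b y w)"
        using assms by (simp add: algebra_simps)
    qed
    finally show ?thesis .
  qed
  ultimately show ?thesis
    unfolding V using tri_cube_Un[OF _ _ disj, of E x] by simp
qed

lemma square_sum_split: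
  "(\<Sum>y\<in>A. \<Sum>w\<in>A. x y * x w * k) = k * (sum x A)^2"
  by (simp add: power2_eq_square mult.commute flip: sum_distrib_left sum_distrib_right)

lemma square_sum_diagonal:
  assumes "finite A"
  shows "(\<Sum>y\<in>A. \<Sum>w\<in>A. x y * x w * of_bool (y = w)) = (\<Sum>y\<in>A. (x y)^2)"
proof (rule sum.cong[OF refl])
  fix y assume "y \<in> A"
  have "(\<Sum>w\<in>A. x y * x w * of_bool (y = w)) = (\<Sum>w\<in>A. if y = w then x y * x w else 0)"
    by (intro sum.cong) auto
  then show "(\<Sum>w\<in>A. x y * x w * of_bool (y = w)) = (x y)^2"
    using assms \<open>y \<in> A\<close> by (simp add: power2_eq_square)
qed

lemma pair_degree_le: "pair_degree a b \<le> sum x (outer a b)"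
  unfolding pair_degree_def
proof (rule sum_mono)
  fix y assume "y \<in> outer a b"
  then show "x y * inc E a b y \<le> x y"
    using mult_left_mono[OF inc_bounds(2) outer_nonneg] by fastforce
qed

text \<open>The diagonal \<open>y = w\<close> carries no edge, which takes off the squares.\<close>

lemma link_sum_le:
  assumes "a < n" "b < n"
  shows "link_sum a b \<le> (x a + x b) * ((sum x (outer a b))^2 - (\<Sum>y\<in>outer a b. (x y)^2))"
proof -
  let ?Z = "outer a b"
  have "link_sum a b \<le> (\<Sum>y\<in>?Z. \<Sum>w\<in>?Z. x y * x w * (x a + x b) - (x a + x b) * (x y * x w * of_bool (y = w)))"
    unfolding link_sum_def
  proof (intro sum_mono)
    fix y w assume yw: "y \<in> ?Z" "w \<in> ?Z"
    have "x a * inc E a y w + x b * inc E b y w \<le> (x a + x b) * (1 - of_bool (y = w))"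
    proof (cases "y = w")
      case True
      then show ?thesis by (simp add: inc_degenerate[OF rgraph])
    next
      case False
      have "x a * inc E a y w + x b * inc E b y w \<le> x a * 1 + x b * 1"
        using nonneg assms inc_bounds by (intro add_mono mult_left_mono) auto
      then show ?thesis using False by simp
    qed
    from mult_left_mono[OF this, of "x y * x w"]
    show "x y * x w * (x a * inc E a y w + x b * inc E b y w)
      \<le> x y * x w * (x a + x b) - (x a + x b) * (x y * x w * of_bool (y = w))"
      using outer_nonneg yw by (simp add: algebra_simps)
  qed
  also have "\<dots> = (x a + x b) * ((sum x ?Z)^2 - (\<Sum>y\<in>?Z. (x y)^2))"
    by (simp only: sum_subtractf square_sum_split square_sum_diagonal[OF finite_outer] sum_distrib_left[symmetric] right_diff_distrib)
  finally show ?thesis .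
qed

text \<open>
  With \<open>\<nu>\<close> the weight of the common neighbourhood of \<open>a\<close> and \<open>b\<close> outside \<open>e\<close>, every pair in it misses an edge to \<open>a\<close> or \<open>b\<close>,
  and \<open>a b \<nu> - b \<nu>\<^sup>2/2 \<le> a\<^sup>2 b/2\<close> bounds what is left whatever \<open>\<nu>\<close> is.
\<close>

lemma pair_loss:
  assumes ab: "a < n" "b < n" "x b \<le> x a" and e: "e \<in> E" "e \<subseteq> outer a b"
  shows "x a * x b * pair_degree a b + link_sum a b / 2
    \<le> x a * x b * sum x e + (x a)^2 * x b / 2
      + (x a + x b)/2 * ((sum x (outer a b))^2 - (\<Sum>y\<in>e. (x y)^2)) - x a / 2 * (\<Sum>y\<in>outer a b - e. (x y)^2)"
proof -
  let ?Z = "outer a b"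
  define Y where "Y = ?Z - e"
  define N where "N = {y \<in> Y. {a,b,y} \<in> E}"
  define \<nu> where "\<nu> = sum x N"
  have fe: "finite e" using e finite_subset finite_outer by blast
  have fY: "finite Y" and fN: "finite N" and NY: "N \<subseteq> Y" and NZ: "N \<subseteq> ?Z" by (auto simp: Y_def N_def)
  have Z: "?Z = e \<union> Y" "e \<inter> Y = {}" using e by (auto simp: Y_def)
  have ge: "0 \<le> x a" "0 \<le> x b" using ab nonneg by auto
  have "pair_degree a b \<le> sum x e + \<nu>"
  proof -
    have "pair_degree a b = (\<Sum>y\<in>e. x y * inc E a b y) + (\<Sum>y\<in>Y. x y * inc E a b y)"
      unfolding pair_degree_def Z(1) by (rule sum.union_disjoint[OF fe fY Z(2)])
    moreover have "(\<Sum>y\<in>e. x y * inc E a b y) \<le> sum x e"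
      using e outer_nonneg mult_left_mono[OF inc_bounds(2)] by (intro sum_mono) fastforce
    moreover have "(\<Sum>y\<in>Y. x y * inc E a b y) = \<nu>"
      unfolding \<nu>_def N_def using fY by (simp add: inc_def of_bool_def sum.inter_filter if_distrib cong: if_cong)
    ultimately show ?thesis by linarith
  qed
  then have deg: "x a * x b * pair_degree a b \<le> x a * x b * (sum x e + \<nu>)"
    using ge by (intro mult_left_mono) auto
  have "link_sum a b \<le> (\<Sum>y\<in>?Z. \<Sum>w\<in>?Z. x y * x w * (x a + x b) - (x a + x b) * (x y * x w * of_bool (y = w))
      - x b * (x y * x w * of_bool (y \<in> N \<and> w \<in> N)) + x b * (x y * x w * of_bool (y \<in> N \<and> w \<in> N \<and> y = w)))"
    unfolding link_sum_def
  proof (intro sum_mono)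
    fix y w assume yw: "y \<in> ?Z" "w \<in> ?Z"
    \<comment> \<open>A pair inside \<open>N\<close> loses at least \<open>x b\<close>, the smaller
      of the two weights. The last summand undoes this on the diagonal, where everything has been
      subtracted already.\<close>
    have "x a * inc E a y w + x b * inc E b y w
      \<le> (x a + x b) - (x a + x b) * of_bool (y = w) - x b * of_bool (y \<in> N \<and> w \<in> N) + x b * of_bool (y \<in> N \<and> w \<in> N \<and> y = w)"
    proof (cases "y = w")
      case True
      then show ?thesis by (simp add: inc_degenerate[OF rgraph])
    next
      case False
      show ?thesis
      proof (cases "y \<in> N \<and> w \<in> N")
        case True
        \<comment> \<open>Such a \<open>K4\<close> would be disjoint from \<open>e\<close>.\<close>
        then have "\<not> K4 E a b y w"
          using meets[of a b y w e] e yw by (auto simp: N_def Y_def outer_def)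
        then have "inc E a y w = 0 \<or> inc E b y w = 0"
          using True by (auto simp: K4_def N_def inc_def)
        moreover have "x a * inc E a y w \<le> x a * 1" "x b * inc E b y w \<le> x b * 1"
          using ge inc_bounds by (intro mult_left_mono; simp)+
        ultimately show ?thesis using True False ab(3) by auto
      next
        case F: False
        have "x a * inc E a y w + x b * inc E b y w \<le> x a * 1 + x b * 1"
          using ge inc_bounds by (intro add_mono mult_left_mono) auto
        then show ?thesis using False F by auto
      qed
    qed
    from mult_left_mono[OF this, of "x y * x w"]
    show "x y * x w * (x a * inc E a y w + x b * inc E b y w)
      \<le> x y * x w * (x a + x b) - (x a + x b) * (x y * x w * of_bool (y = w))
      - x b * (x y * x w * of_bool (y \<in> N \<and> w \<in> N)) + x b * (x y * x w * of_bool (y \<in> N \<and> w \<in> N \<and> y = w))"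
      using outer_nonneg yw by (simp add: algebra_simps)
  qed
  also have "\<dots> = (x a + x b) * (sum x ?Z)^2 - (x a + x b) * (\<Sum>y\<in>?Z. (x y)^2) - x b * \<nu>^2 + x b * (\<Sum>y\<in>N. (x y)^2)"
  proof -
    have restr: "(\<Sum>y\<in>?Z. \<Sum>w\<in>?Z. g y w * of_bool (y \<in> N \<and> w \<in> N \<and> P y w)) = (\<Sum>y\<in>N. \<Sum>w\<in>N. g y w * of_bool (P y w))"
      for g :: "nat \<Rightarrow> nat \<Rightarrow> real" and P
    proof -
      have "(\<Sum>y\<in>?Z. \<Sum>w\<in>?Z. g y w * of_bool (y \<in> N \<and> w \<in> N \<and> P y w))
          = (\<Sum>y\<in>N. \<Sum>w\<in>?Z. g y w * of_bool (y \<in> N \<and> w \<in> N \<and> P y w))"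
        by (rule sum.mono_neutral_right[OF finite_outer NZ]) auto
      also have "\<dots> = (\<Sum>y\<in>N. \<Sum>w\<in>N. g y w * of_bool (y \<in> N \<and> w \<in> N \<and> P y w))"
        by (intro sum.cong refl sum.mono_neutral_right[OF finite_outer NZ]) auto
      finally show ?thesis by simp
    qed
    have "(\<Sum>y\<in>?Z. \<Sum>w\<in>?Z. x y * x w * of_bool (y \<in> N \<and> w \<in> N)) = \<nu>^2"
      using restr[of "\<lambda>y w. x y * x w" "\<lambda>_ _. True"] square_sum_split[where A = N and k = 1] by (simp add: \<nu>_def)
    moreover have "(\<Sum>y\<in>?Z. \<Sum>w\<in>?Z. x y * x w * of_bool (y \<in> N \<and> w \<in> N \<and> y = w)) = (\<Sum>y\<in>N. (x y)^2)"
      using restr[of "\<lambda>y w. x y * x w" "\<lambda>y w. y = w"] square_sum_diagonal[OF fN] by simp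
    ultimately show ?thesis
      by (simp only: sum_subtractf sum.distrib square_sum_split square_sum_diagonal[OF finite_outer] sum_distrib_left[symmetric])
  qed
  finally have link: "link_sum a b \<le> \<dots>" .
  \<comment> \<open>The diagonal restored on \<open>N\<close> can at most cancel the
    \<open>x b\<close> part of the squares over \<open>Y\<close>; the \<open>x a\<close> part
    survives.\<close>
  have "(\<Sum>y\<in>N. (x y)^2) \<le> (\<Sum>y\<in>Y. (x y)^2)"
    by (rule sum_mono2[OF fY NY]) simp
  then have "x b * (\<Sum>y\<in>N. (x y)^2) \<le> x b * (\<Sum>y\<in>Y. (x y)^2)"
    using ge by (intro mult_left_mono) auto
  moreover have "(\<Sum>y\<in>?Z. (x y)^2) = (\<Sum>y\<in>e. (x y)^2) + (\<Sum>y\<in>Y. (x y)^2)"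
    unfolding Z(1) by (rule sum.union_disjoint[OF fe fY Z(2)])
  moreover have "x a * x b * \<nu> - x b / 2 * \<nu>^2 \<le> (x a)^2 * x b / 2"
  proof -
    have "0 \<le> x b * (x a - \<nu>)^2" using ge by simp
    then show ?thesis by (simp add: poly_simps)
  qed
  ultimately show ?thesis
    using deg link unfolding Y_def[symmetric] by (simp add: algebra_simps add_divide_distrib diff_divide_distrib)
qed

section \<open>Two copies of \<open>K4\<close> sharing exactly a pair\<close>

lemma crossing:
  assumes "K4 E a b c d" "K4 E a b u v" "e \<in> E" "e \<inter> {a,b} = {}"
  shows "e \<inter> {c,d} \<noteq> {}" "e \<inter> {u,v} \<noteq> {}"
  using meets[OF assms(1,3)] meets[OF assms(2,3)] assms(4) by auto

text \<open>By \<open>crossing\<close>, an edge avoiding \<open>{a,b}\<close> meets both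
  \<open>{c,d}\<close> and \<open>{u,v}\<close>. Hence it lies inside these four vertices, or has
  one vertex in each pair and its third in \<open>R\<close>; the second conclusion is for graphs
  without edges of the latter kind.\<close>

lemma outer_tri_bound:
  assumes K: "K4 E a b c d" "K4 E a b u v" and disj: "{c,d} \<inter> {u,v} = {}"
  defines "R \<equiv> outer a b - {c,d,u,v}"
  shows "tri E x (outer a b) (outer a b) (outer a b)
      \<le> 6 * (x c * x d * (x u + x v) + x u * x v * (x c + x d)) + 6 * ((x c + x d) * (x u + x v) * sum x R)"
    and "\<forall>e\<in>E. e \<inter> {a,b} = {} \<longrightarrow> e \<inter> R = {} \<Longrightarrow> tri E x (outer a b) (outer a b) (outer a b)
      \<le> 6 * (x c * x d * (x u + x v) + x u * x v * (x c + x d))"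
proof -
  let ?Z = "outer a b" and ?C = "{c,d}" and ?U = "{u,v}"
  note d1 = K4_distinct[OF rgraph K(1)] and d2 = K4_distinct[OF rgraph K(2)]
  note deg = inc_degenerate[OF rgraph]
  have CU: "?C \<subseteq> ?Z" "?U \<subseteq> ?Z"
    using K4_subset[OF rgraph K(1)] K4_subset[OF rgraph K(2)] d1 d2 by (auto simp: outer_def)
  have Z: "?Z = (?C \<union> ?U) \<union> R" and disjR: "(?C \<union> ?U) \<inter> R = {}" and finR: "finite R"
    using CU by (auto simp: R_def)
  have ab: "i \<notin> {a,b}" if "i \<in> ?Z" for i using that by (auto simp: outer_def)
  have zero: "tri E x A B D = 0"
    if "A \<union> B \<union> D \<subseteq> ?Z" "(A \<union> B \<union> D) \<inter> ?C = {} \<or> (A \<union> B \<union> D) \<inter> ?U = {}" for A B D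
  proof (rule tri_eq_0, rule notI)
    fix i j k assume ijk: "i \<in> A" "j \<in> B" "k \<in> D" "{i,j,k} \<in> E"
    then have sub: "{i,j,k} \<subseteq> A \<union> B \<union> D" by auto
    then have "i \<in> ?Z" "j \<in> ?Z" "k \<in> ?Z" using that(1) by auto
    then have "{i,j,k} \<inter> {a,b} = {}" using ab by simp
    note cross = crossing[OF K ijk(4) this]
    from that(2) show False
    proof
      assume "(A \<union> B \<union> D) \<inter> ?C = {}"
      then have "{i,j,k} \<inter> ?C = {}" using sub by fast
      with cross(1) show False by contradiction
    next
      assume "(A \<union> B \<union> D) \<inter> ?U = {}"
      then have "{i,j,k} \<inter> ?U = {}" using sub by fast
      with cross(2) show False by contradiction
    qed
  qed
  have RC: "R \<inter> ?C = {}" "R \<inter> ?U = {}" "R \<subseteq> ?Z" by (auto simp: R_def)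
  have nn: "0 \<le> x i" if "i \<in> ?Z" for i using that by (rule outer_nonneg)
  have "tri E x ?C ?C ?U \<le> 2 * (x c * x d * (x u + x v))"
  proof -
    have "tri E x ?C ?C ?U = 2 * (x c * x d * (x u * inc E c d u + x v * inc E c d v))"
      using d1 d2 by (simp add: tri_def deg inc_swap(1)[of E d c] algebra_simps)
    also have "\<dots> \<le> 2 * (x c * x d * (x u * 1 + x v * 1))"
      using CU nn inc_bounds by (intro mult_left_mono add_mono) auto
    finally show ?thesis by simp
  qed
  moreover have "tri E x ?C ?U ?U \<le> 2 * (x u * x v * (x c + x d))"
  proof -
    have "tri E x ?C ?U ?U = 2 * (x u * x v * (x c * inc E c u v + x d * inc E d u v))"
      using d1 d2 by (simp add: tri_def deg inc_swap(2)[of E _ v u] algebra_simps)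
    also have "\<dots> \<le> 2 * (x u * x v * (x c * 1 + x d * 1))"
      using CU nn inc_bounds by (intro mult_left_mono add_mono) auto
    finally show ?thesis by simp
  qed
  moreover have "tri E x ?C ?C ?C = 0" "tri E x ?U ?U ?U = 0"
    by (intro zero; use CU disj in auto)+
  ultimately have inner: "tri E x (?C \<union> ?U) (?C \<union> ?U) (?C \<union> ?U) \<le> 6 * (x c * x d * (x u + x v) + x u * x v * (x c + x d))"
    using tri_cube_Un[OF _ _ disj, of E x] by simp
  have WRR: "tri E x (?C \<union> ?U) R R = 0"
  proof -
    have "tri E x ?C R R = 0" "tri E x ?U R R = 0"
      by (intro zero; use CU RC disj in auto)+
    then show ?thesis by (subst tri_Un1[OF _ _ disj]) auto
  qed
  have RRR: "tri E x R R R = 0"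
    using RC by (intro zero) auto
  have split: "tri E x ?Z ?Z ?Z = tri E x (?C \<union> ?U) (?C \<union> ?U) (?C \<union> ?U) + 3 * tri E x (?C \<union> ?U) (?C \<union> ?U) R"
    unfolding Z using tri_cube_Un[OF _ finR disjR, of E x] WRR RRR by simp
  have "tri E x (?C \<union> ?U) (?C \<union> ?U) R = 2 * tri E x ?C ?U R"
  proof -
    have "tri E x (?C \<union> ?U) (?C \<union> ?U) R = tri E x ?C ?C R + tri E x ?C ?U R + (tri E x ?U ?C R + tri E x ?U ?U R)"
      by (simp only: tri_Un1[OF _ _ disj] tri_Un2[OF _ _ disj] finite.intros)
    moreover have "tri E x ?C ?C R = 0" "tri E x ?U ?U R = 0"
      by (intro zero; use CU RC disj in auto)+
    moreover have "tri E x ?U ?C R = tri E x ?C ?U R" by (rule tri_swap12)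
    ultimately show ?thesis by simp
  qed
  moreover have "tri E x ?C ?U R \<le> (x c + x d) * (x u + x v) * sum x R"
    using tri_le[of ?C ?U R x E] CU RC nn d1 d2 by auto
  ultimately show "tri E x ?Z ?Z ?Z
      \<le> 6 * (x c * x d * (x u + x v) + x u * x v * (x c + x d)) + 6 * ((x c + x d) * (x u + x v) * sum x R)"
    using split inner by simp
  show "tri E x ?Z ?Z ?Z \<le> 6 * (x c * x d * (x u + x v) + x u * x v * (x c + x d))"
    if "\<forall>e\<in>E. e \<inter> {a,b} = {} \<longrightarrow> e \<inter> R = {}"
  proof -
    have "tri E x (?C \<union> ?U) (?C \<union> ?U) R = 0"
    proof (rule tri_eq_0, rule notI)
      fix i j k assume ijk: "i \<in> ?C \<union> ?U" "j \<in> ?C \<union> ?U" "k \<in> R" "{i,j,k} \<in> E"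
      then have "i \<in> ?Z" "j \<in> ?Z" "k \<in> ?Z" using CU RC(3) by auto
      then have "{i,j,k} \<inter> {a,b} = {}" using ab by simp
      then have "{i,j,k} \<inter> R = {}" using that ijk(4) by simp
      then show False using ijk(3) by simp
    qed
    then show ?thesis using split inner by simp
  qed
qed

text \<open>Opaque names for the products keep the final combination linear; the factor 6 from
  ordered triples turns \<open>s/18\<close> into \<open>s/3\<close>.\<close>

lemma core_combine:
  fixes p l t :: real
  assumes "p + l/2 \<le> B" "t \<le> 6 * c + 6 * d" "B + c + d \<le> s/18" "T = 6 * p + 3 * l + t"
  shows "T \<le> s/3"
  using assms by linarith

lemma core_bound_crossing:
  assumes K: "K4 E a b c d" "K4 E a b u v" and disj: "{c,d} \<inter> {u,v} = {}"
    and ab: "x b \<le> x a" and e: "{c,u,w} \<in> E" "w \<notin> {a,b,c,d,u,v}" and light: "x a + x b \<le> 97/200"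
  shows "tri E x V V V \<le> sqrt 3 / 3"
proof -
  let ?Z = "outer a b" and ?e = "{c,u,w}"
  note d1 = K4_distinct[OF rgraph K(1)] and d2 = K4_distinct[OF rgraph K(2)]
  have lt: "a < n" "b < n" "c < n" "d < n" "u < n" "v < n"
    using K4_subset[OF rgraph K(1)] K4_subset[OF rgraph K(2)] by auto
  have w: "w < n" using e rgraph by (auto simp: is_rgraph_def)
  have eZ: "?e \<subseteq> ?Z" using lt w d1 d2 e(2) by (auto simp: outer_def)
  have card: "c \<noteq> u" "c \<noteq> w" "u \<noteq> w" "c \<noteq> v" "d \<noteq> u" "d \<noteq> v" using disj e(2) by auto
  define R where "R = ?Z - {c,d,u,v}"
  have R: "sum x ?Z = x c + x d + x u + x v + sum x R"
  proof -
    have "?Z = {c,d,u,v} \<union> R" using lt d1 d2 by (auto simp: outer_def R_def)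
    then have "sum x ?Z = sum x {c,d,u,v} + sum x R"
      using sum.union_disjoint[of "{c,d,u,v}" R x] by (auto simp: R_def)
    then show ?thesis using d1 d2 card by simp
  qed
  \<comment> \<open>Of the squares outside the edge, those of \<open>d\<close> and \<open>v\<close>
    are enough.\<close>
  have "(\<Sum>y\<in>{d,v}. (x y)^2) \<le> (\<Sum>y\<in>?Z - ?e. (x y)^2)"
    by (rule sum_mono2) (use lt d1 d2 card e(2) in \<open>auto simp: outer_def\<close>)
  then have "x a/2 * ((x d)^2 + (x v)^2) \<le> x a / 2 * (\<Sum>y\<in>?Z - ?e. (x y)^2)"
    using nonneg lt card by (intro mult_left_mono) auto
  moreover have "(\<Sum>y\<in>?e. (x y)^2) = (x c)^2 + (x u)^2 + (x w)^2" "sum x ?e = x c + x u + x w"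
    using card by simp_all
  ultimately have 1: "x a * x b * pair_degree a b + link_sum a b / 2
    \<le> x a * x b * (x c + x u + x w) + (x a)^2 * x b / 2
      + (x a + x b)/2 * ((sum x ?Z)^2 - ((x c)^2 + (x u)^2 + (x w)^2)) - x a/2 * ((x d)^2 + (x v)^2)"
    using pair_loss[OF lt(1,2) ab e(1) eZ] by simp
  have 2: "tri E x ?Z ?Z ?Z
      \<le> 6 * (x c * x d * (x u + x v) + x u * x v * (x c + x d)) + 6 * ((x c + x d) * (x u + x v) * (sum x ?Z - x c - x d - x u - x v))"
    using outer_tri_bound(1)[OF K disj] R unfolding R_def by simp
  have "x a + x b + sum x ?Z = 1" by (rule sum_outer[OF lt(1,2) d1(1)])
  then have "x a * x b * (x c + x u + x w) + (x a)^2 * x b/2 + (x a + x b)/2 * ((sum x ?Z)^2 - ((x c)^2 + (x u)^2 + (x w)^2))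
      - x a/2 * ((x d)^2 + (x v)^2) + (x c * x d * (x u + x v) + x u * x v * (x c + x d))
      + (x c + x d) * (x u + x v) * (sum x ?Z - x c - x d - x u - x v) \<le> sqrt 3 / 18"
    using nonneg lt w ab light by (intro core_bound_outer) auto
  from core_combine[OF 1 2 this tri_split_pair[OF lt(1,2) d1(1)]] show ?thesis .
qed

text \<open>Three cases: no edge avoiding \<open>{a,b}\<close> reaches \<open>R\<close>; such an
  edge exists and the pair is light; such an edge exists and the pair is heavy.\<close>

lemma core_bound:
  assumes K: "K4 E a b c d" "K4 E a b u v" and disj: "{c,d} \<inter> {u,v} = {}" and ab: "x b \<le> x a"
  shows "tri E x V V V \<le> sqrt 3 / 3"
proof -
  let ?Z = "outer a b"
  define R where "R = ?Z - {c,d,u,v}"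
  note d1 = K4_distinct[OF rgraph K(1)] and d2 = K4_distinct[OF rgraph K(2)]
  have lt: "a < n" "b < n" "c < n" "d < n" "u < n" "v < n"
    using K4_subset[OF rgraph K(1)] K4_subset[OF rgraph K(2)] by auto
  have card: "c \<noteq> u" "c \<noteq> v" "d \<noteq> u" "d \<noteq> v" using disj by auto
  have Z: "?Z = {c,d,u,v} \<union> R" using lt d1 d2 by (auto simp: outer_def R_def)
  have "sum x ?Z = sum x {c,d,u,v} + sum x R"
    unfolding Z by (rule sum.union_disjoint) (auto simp: R_def)
  then have R: "sum x ?Z = x c + x d + x u + x v + sum x R"
    using d1 d2 card by simp
  have R0: "0 \<le> sum x R" using outer_nonneg by (intro sum_nonneg) (auto simp: R_def)
  have nn: "0 \<le> x a" "0 \<le> x b" "0 \<le> x c" "0 \<le> x d" "0 \<le> x u" "0 \<le> x v" using nonneg lt by auto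
  have one: "x a + x b + sum x ?Z = 1" by (rule sum_outer[OF lt(1,2) d1(1)])
  have "(\<Sum>y\<in>{c,d,u,v}. (x y)^2) \<le> (\<Sum>y\<in>?Z. (x y)^2)"
    by (rule sum_mono2[OF finite_outer]) (use Z in auto)
  then have "(x a + x b) * ((sum x ?Z)^2 - (\<Sum>y\<in>?Z. (x y)^2))
      \<le> (x a + x b) * ((sum x ?Z)^2 - ((x c)^2 + (x d)^2 + (x u)^2 + (x v)^2))"
    using nn d1 d2 card by (intro mult_left_mono) auto
  then have link: "link_sum a b \<le> (x a + x b) * ((sum x ?Z)^2 - ((x c)^2 + (x d)^2 + (x u)^2 + (x v)^2))"
    using link_sum_le[OF lt(1,2)] by linarith
  have deg: "x a * x b * pair_degree a b \<le> x a * x b * sum x ?Z"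
    using pair_degree_le nn by (intro mult_left_mono) auto
  note split = tri_split_pair[OF lt(1,2) d1(1)]
  note bound = outer_tri_bound[OF K disj, folded R_def]
  show ?thesis
  proof (cases "\<forall>e\<in>E. e \<inter> {a,b} = {} \<longrightarrow> e \<inter> R = {}")
    case True
    have "x a * x b * sum x ?Z + (x a + x b)/2 * ((sum x ?Z)^2 - ((x c)^2 + (x d)^2 + (x u)^2 + (x v)^2))
        + (x c * x d * (x u + x v) + x u * x v * (x c + x d)) \<le> sqrt 3 / 18"
      using nn one R R0 by (intro core_bound_inner) auto
    then show ?thesis using split deg link bound(2)[OF True] by simp
  next
    case False
    then obtain e w where e: "e \<in> E" "e \<inter> {a,b} = {}" "w \<in> e" "w \<in> R" by blast
    show ?thesis
    proof (cases "x a + x b \<le> 97/200")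
      case True
      \<comment> \<open>The edge has a vertex in each of the two pairs and \<open>w\<close> in
        \<open>R\<close>. These exhaust it, so after renaming inside the pairs it has the form
        \<open>{c,u,w}\<close>.\<close>
      obtain c' u' where cu: "c' \<in> e" "c' \<in> {c,d}" "u' \<in> e" "u' \<in> {u,v}"
        using crossing[OF K e(1,2)] by blast
      have ne: "c' \<noteq> u'" "c' \<noteq> w" "u' \<noteq> w" using cu disj e(4) by (auto simp: R_def)
      have "card e = 3" "finite e" using e(1) rgraph by (auto simp: is_rgraph_def intro: card_ge_0_finite)
      then have "{c',u',w} = e"
        using ne cu e(3) by (intro card_subset_eq) auto
      then have E: "{c',u',w} \<in> E" using e(1) by simp
      obtain d' where d': "{c',d'} = {c,d}" using cu(2) by auto
      obtain v' where v': "{u',v'} = {u,v}" using cu(4) by auto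
      have "K4 E a b c' d'" using K(1) d' by (auto simp: doubleton_eq_iff K4_swap(2)[of E a b])
      moreover have "K4 E a b u' v'" using K(2) v' by (auto simp: doubleton_eq_iff K4_swap(2)[of E a b])
      moreover have "{c',d'} \<inter> {u',v'} = {}" using disj d' v' by simp
      moreover have "w \<notin> {a,b,c',d',u',v'}"
        using e(2-4) d' v' by (auto simp: R_def doubleton_eq_iff)
      ultimately show ?thesis using core_bound_crossing[OF _ _ _ ab E] True by blast
    next
      case False
      have r: "sum x R = sum x ?Z - x c - x d - x u - x v" using R by simp
      have "x a * x b * sum x ?Z + (x a + x b)/2 * ((sum x ?Z)^2 - ((x c)^2 + (x d)^2 + (x u)^2 + (x v)^2))
        + (x c * x d * (x u + x v) + x u * x v * (x c + x d)) + (x c + x d) * (x u + x v) * sum x R \<le> sqrt 3 / 18"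
        unfolding r using nn one R R0 False by (intro core_bound_heavy_pair) auto
      then show ?thesis using split deg link bound(1) by simp
    qed
  qed
qed

theorem tri_bound:
  "tri E x V V V \<le> sqrt 3 / 3"
proof (cases "\<exists>a b c d. K4 E a b c d")
  case False
  have "tri E x V V V \<le> 577/1000"
  proof (rule K4_free_tri_le)
    show "sum x V = 1" by (rule total)
    show "\<not> ({a, b, c} \<in> E \<and> {a, b, d} \<in> E \<and> {a, c, d} \<in> E \<and> {b, c, d} \<in> E)" for a b c d
      using False unfolding K4_def by blast
  qed (auto simp: nonneg)
  then show ?thesis using sqrt3_bound by simp
next
  case True
  then obtain a b c d where T: "K4 E a b c d" by blast
  show ?thesis
  proof (cases "\<exists>s t u v. {s,t} \<subseteq> {a,b,c,d} \<and> s \<noteq> t \<and> u \<notin> {a,b,c,d} \<and> v \<notin> {a,b,c,d} \<and> K4 E s t u v")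
    case False
    then have "tri E x V V V \<le> 72/125" by (intro spread_bound[OF T]) blast
    then show ?thesis using sqrt3_bound by simp
  next
    case True
    then obtain s t u v where st: "{s,t} \<subseteq> {a,b,c,d}" "s \<noteq> t" "u \<notin> {a,b,c,d}" "v \<notin> {a,b,c,d}" "K4 E s t u v"
      by blast
    \<comment> \<open>\<open>T\<close> is to be read as a \<open>K4\<close> whose first two vertices
      are \<open>s\<close> and \<open>t\<close>, in either order.\<close>
    define P where "P s t \<longleftrightarrow> (\<exists>p q. K4 E s t p q \<and> {p,q} \<subseteq> {a,b,c,d})" for s t
    have "P s t"
    proof -
      have "P a b" "P a c" "P a d" "P b c" "P b d" "P c d" "P b a" "P c a" "P d a" "P c b" "P d b" "P d c"
        unfolding P_def using T K4_pairs[OF T] by blast+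
      then show ?thesis using st(1,2) by auto
    qed
    then obtain p q where pq: "K4 E s t p q" "{p,q} \<subseteq> {a,b,c,d}" unfolding P_def by blast
    have disj: "{p,q} \<inter> {u,v} = {}" using pq(2) st(3,4) by auto
    show ?thesis
    proof (cases "x t \<le> x s")
      case True
      then show ?thesis by (rule core_bound[OF pq(1) st(5) disj])
    next
      case False
      have "K4 E t s p q" "K4 E t s u v" using pq(1) st(5) by (simp_all add: K4_swap(1)[of E t s])
      from core_bound[OF this disj] False show ?thesis by simp
    qed
  qed
qed

end

section \<open>The Lagrangian density\<close>

lemma vertices_eq: "K43_e_vertices = {1,2,3,4,5,6,7}"
  by (auto simp: K43_e_vertices_def)

lemma contains_copyI:
  assumes rg: "is_rgraph 3 n E" and K: "K4 E a b c d" and e: "e \<in> E" "e \<inter> {a,b,c,d} = {}"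
  shows "contains_copy K43_e_vertices K43_e_edges {0..<n} E"
proof -
  have "card e = 3" "e \<subseteq> {0..<n}" using rg e(1) by (auto simp: is_rgraph_def)
  then obtain p q r where pqr: "e = {p,q,r}" "p \<noteq> q" "p \<noteq> r" "q \<noteq> r"
    by (auto simp: card_3_iff)
  \<comment> \<open>Labels 1 to 4 go to the \<open>K4\<close> and 5 to 7 to the edge; among the
    labels in use, only 7 reaches the final branch.\<close>
  define f :: "nat \<Rightarrow> nat" where
    "f i = (if i = 1 then a else if i = 2 then b else if i = 3 then c else if i = 4 then d
      else if i = 5 then p else if i = 6 then q else r)" for i
  have "inj_on f K43_e_vertices"
    using K4_distinct[OF rg K] pqr e(2) by (auto simp: vertices_eq f_def)
  moreover have "f ` K43_e_vertices \<subseteq> {0..<n}"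
    using K4_subset[OF rg K] pqr \<open>e \<subseteq> {0..<n}\<close> by (auto simp: vertices_eq f_def)
  moreover have "\<forall>e\<in>K43_e_edges. f ` e \<in> E"
    using K e(1) unfolding pqr(1) by (simp add: K43_e_edges_def f_def K4_def insert_commute)
  ultimately show ?thesis unfolding contains_copy_def by blast
qed

lemma K4_edge_freeI:
  assumes "is_rgraph 3 n E" "\<not> contains_copy K43_e_vertices K43_e_edges {0..<n} E" "x \<in> simplex n"
  shows "K4_edge_free n E x"
proof
  show "e \<inter> {a,b,c,d} \<noteq> {}" if "K4 E a b c d" "e \<in> E" for a b c d e
    using contains_copyI[OF assms(1) that] assms(2) by blast
qed (use assms in \<open>auto simp: simplex_def atLeast0LessThan\<close>)

lemma lam_poly_le:
  assumes "is_rgraph 3 n E" "\<not> contains_copy K43_e_vertices K43_e_edges {0..<n} E" "x \<in> simplex n"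
  shows "lam_poly E x \<le> sqrt 3 / 18"
proof -
  interpret K4_edge_free n E x by (rule K4_edge_freeI[OF assms])
  show ?thesis using tri_bound tri_eq_lam_poly[OF assms(1), of x] by simp
qed

lemma simplex_nonempty: "1 \<le> n \<Longrightarrow> simplex n \<noteq> {}"
proof -
  assume "1 \<le> n"
  then have "(\<lambda>i. of_bool (i = 0)) \<in> simplex n"
    by (simp add: simplex_def of_bool_def sum.delta')
  then show ?thesis by blast
qed

lemma lagrangian_le:
  assumes "1 \<le> n" "is_rgraph 3 n E" "\<not> contains_copy K43_e_vertices K43_e_edges {0..<n} E"
  shows "lagrangian n E \<le> sqrt 3 / 18"
  unfolding lagrangian_def
  by (rule cSUP_least) (use simplex_nonempty lam_poly_le assms in auto)

section \<open>Lower bound: all triples meeting two fixed vertices\<close>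

definition two_star :: "nat \<Rightarrow> nat set set" where
  "two_star n = {e. e \<subseteq> {0..<n} \<and> card e = 3 \<and> e \<inter> {0,1} \<noteq> {}}"

lemma two_star_rgraph: "is_rgraph 3 n (two_star n)"
  by (simp add: is_rgraph_def two_star_def)

text \<open>In a copy, the preimage of \<open>{0,1}\<close> would meet every edge with at most two
  vertices. Three are necessary: two for the \<open>K4\<close> and one for the disjoint
  edge.\<close>

lemma two_star_free: "\<not> contains_copy K43_e_vertices K43_e_edges {0..<n} (two_star n)"
proof
  assume "contains_copy K43_e_vertices K43_e_edges {0..<n} (two_star n)"
  then obtain f where "inj_on f K43_e_vertices" and edge: "\<forall>e\<in>K43_e_edges. f ` e \<in> two_star n"
    unfolding contains_copy_def by blast
  then have inj: "inj_on f {1,2,3,4,5,6,7}" by (simp only: vertices_eq)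
  have hit: "\<exists>i\<in>e. f i \<in> {0,1}" if "e \<in> K43_e_edges" for e
  proof -
    have "f ` e \<inter> {0,1} \<noteq> {}" using edge that by (simp add: two_star_def)
    then show ?thesis by blast
  qed
  have "\<exists>i\<in>{5,6,7}. f i \<in> {0,1}" "\<exists>i\<in>{1,2,3}. f i \<in> {0,1}"
    by (rule hit, simp add: K43_e_edges_def)+
  then obtain y j where y: "y \<in> {5,6,7}" "f y \<in> {0,1}" and j: "j \<in> {1,2,3}" "f j \<in> {0,1}"
    by (elim bexE)
  \<comment> \<open>Removing \<open>j\<close> from the \<open>K4\<close> leaves an edge, which
    yields a second vertex sent into \<open>{0,1}\<close>.\<close>
  have "{1,2,3,4} - {j} \<in> K43_e_edges"
  proof -
    have "{1,2,3,4} - {1} = {2,3,4::nat}" "{1,2,3,4} - {2} = {1,3,4::nat}" "{1,2,3,4} - {3} = {1,2,4::nat}"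
      by auto
    moreover have "j = 1 \<or> j = 2 \<or> j = 3" using j(1) by simp
    ultimately show ?thesis unfolding K43_e_edges_def by (elim disjE) simp_all
  qed
  then obtain k where k: "k \<in> {1,2,3,4} - {j}" "f k \<in> {0,1}" using hit by blast
  have "y \<in> {1,2,3,4,5,6,7}" "j \<in> {1,2,3,4,5,6,7}" "k \<in> {1,2,3,4,5,6,7}" "j \<noteq> y" "k \<noteq> y" "j \<noteq> k"
    using y(1) j(1) k(1) by auto
  then have "f j \<noteq> f y" "f k \<noteq> f y" "f j \<noteq> f k"
    by (simp_all only: inj_on_eq_iff[OF inj] not_False_eq_True)
  then show False using y(2) j(2) k(2) by auto
qed

text \<open>The centres get weight \<open>(1 - s)/2\<close> each, and \<open>s\<close> is shared
  equally by the other \<open>N\<close> vertices, with \<open>s\<close> the maximiser from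
  \<open>cubic_le_sqrt3\<close>. Only the diagonal, of weight \<open>s^2 / N\<close>, separates the
  value from the limit.\<close>

lemma two_star_lam_poly:
  assumes "1 \<le> N"
  shows "\<exists>x\<in>simplex (N + 2). sqrt 3 / 3 - 3 / real N \<le> 6 * lam_poly (two_star (N + 2)) x"
proof -
  define s where "s = sqrt 3 / 3"
  define x where "x i = (if i < 2 then (1 - s)/2 else s / real N)" for i :: nat
  define n where "n = N + 2"
  let ?E = "two_star n"
  have n: "2 \<le> n" "n - 2 = N" by (simp_all add: n_def)
  have ss: "s * s = 1/3" by (simp add: s_def)
  have s: "0 \<le> s" "s \<le> 1"
    using power2_le_imp_le[of s 1] ss by (auto simp: s_def power2_eq_square)
  have nn: "0 \<le> x i" for i using s by (simp add: x_def)
  have "{0..<n} = {0,1} \<union> {2..<n}" using n(1) by auto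
  then have "sum x {0..<n} = sum x {0,1} + sum x {2..<n}"
    using sum.union_disjoint[of "{0,1}" "{2..<n}" x] by simp
  also have "\<dots> = 1" using assms n by (simp add: x_def)
  finally have one: "sum x {0..<n} = 1" .
  have simplex: "x \<in> simplex n" using nn one by (simp add: simplex_def atLeast0LessThan)
  \<comment> \<open>The graph is itself free, so the splitting at the pair \<open>0, 1\<close>
    applies to it.\<close>
  interpret K4_edge_free n ?E x
    by (rule K4_edge_freeI[OF two_star_rgraph two_star_free simplex])
  have Z: "outer 0 1 = {2..<n}" unfolding outer_def using n(1) by auto
  have xZ: "x y = s / real N" if "y \<in> {2..<n}" for y using that by (simp add: x_def)
  have x01: "x 0 = (1 - s)/2" "x (Suc 0) = (1 - s)/2" by (simp_all add: x_def)
  have sumZ: "sum x {2..<n} = s" using xZ assms n by simp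
  have "pair_degree 0 1 = sum x {2..<n}"
    unfolding pair_degree_def Z by (intro sum.cong refl) (auto simp: inc_def two_star_def)
  then have deg: "pair_degree 0 1 = s" by (simp only: sumZ)
  have "link_sum 0 1 = (\<Sum>y\<in>{2..<n}. \<Sum>w\<in>{2..<n}. x y * x w * (1 - s) - (1 - s) * (x y * x w * of_bool (y = w)))"
    unfolding link_sum_def Z by (intro sum.cong refl) (auto simp: inc_def two_star_def x01 algebra_simps add_divide_distrib diff_divide_distrib)
  also have "\<dots> = (1 - s) * s^2 - (1 - s) * (\<Sum>y\<in>{2..<n}. (x y)^2)"
    by (simp only: sum_subtractf square_sum_split square_sum_diagonal[OF finite_atLeastLessThan] sum_distrib_left[symmetric] sumZ)
  also have "(\<Sum>y\<in>{2..<n}. (x y)^2) = s^2 / real N"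
    using assms n by (simp add: xZ power2_eq_square)
  finally have link: "link_sum 0 1 = (1 - s) * s^2 - (1 - s) * (s^2 / real N)" .
  have "tri ?E x (outer 0 1) (outer 0 1) (outer 0 1) = 0"
    unfolding Z by (rule tri_eq_0) (auto simp: two_star_def)
  then have "6 * lam_poly ?E x = 6 * ((1 - s)/2 * ((1 - s)/2) * s) + 3 * ((1 - s) * s^2 - (1 - s) * (s^2 / real N))"
    using tri_split_pair[of 0 1] deg link tri_eq_lam_poly[OF two_star_rgraph, of n x] n by (simp add: x_def)
  also have "\<dots> = 3/2 * s - 3/2 * (s * s) * s - 3 * ((1 - s) * s^2) / real N"
    by (simp add: poly_simps)
  also have "\<dots> = s - 3 * ((1 - s) * s^2) / real N"
    unfolding ss by simp
  also have "\<dots> \<ge> s - 3 * (1 * 1^2) / real N"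
    using s by (intro diff_left_mono divide_right_mono mult_left_mono mult_mono power_mono) auto
  finally have "s - 3 / real N \<le> 6 * lam_poly ?E x" by simp
  then show ?thesis using simplex unfolding s_def n_def by blast
qed

theorem theorem1p4:
  shows "lagrangian_density 3 K43_e_vertices K43_e_edges = sqrt 3 / 3"
proof -
  define A where "A = {fact 3 * lagrangian n E | n E. 1 \<le> n \<and> is_rgraph 3 n E \<and>
    \<not> contains_copy K43_e_vertices K43_e_edges {0..<n} E}"
  have fact3: "fact 3 = (6::real)" by (simp add: fact_numeral)
  have le: "a \<le> sqrt 3 / 3" if "a \<in> A" for a
    using that lagrangian_le unfolding A_def fact3 by fastforce
  have mem: "6 * lagrangian (N + 2) (two_star (N + 2)) \<in> A" for N
    unfolding A_def fact3 using two_star_rgraph two_star_free by fastforce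
  have "Sup A \<le> sqrt 3 / 3"
    using mem[of 0] le by (intro cSup_least) auto
  moreover have "sqrt 3 / 3 \<le> Sup A"
  proof (rule field_le_epsilon)
    fix \<epsilon> :: real assume "0 < \<epsilon>"
    obtain N where N: "3 / \<epsilon> < real N" using reals_Archimedean2 by blast
    with \<open>0 < \<epsilon>\<close> have "0 < real N" by (smt (verit) divide_pos_pos)
    then have N1: "1 \<le> N" by simp
    from N have "3 / real N < \<epsilon>"
      using \<open>0 < \<epsilon>\<close> \<open>0 < real N\<close> by (simp add: field_simps)
    moreover obtain x where x: "x \<in> simplex (N + 2)" "sqrt 3 / 3 - 3 / real N \<le> 6 * lam_poly (two_star (N + 2)) x"
      using two_star_lam_poly[OF N1] by blast
    \<comment> \<open>The upper bound for free graphs also provides the boundedness that the suprema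
      require.\<close>
    moreover have "lam_poly (two_star (N + 2)) x \<le> lagrangian (N + 2) (two_star (N + 2))"
      unfolding lagrangian_def
      by (rule cSUP_upper[OF x(1)])
        (auto intro!: bdd_aboveI[of _ "sqrt 3 / 18"] lam_poly_le[OF two_star_rgraph two_star_free])
    moreover have "6 * lagrangian (N + 2) (two_star (N + 2)) \<le> Sup A"
      using mem le by (intro cSup_upper bdd_aboveI)
    ultimately show "sqrt 3 / 3 \<le> Sup A + \<epsilon>" by linarith
  qed
  ultimately show ?thesis unfolding lagrangian_density_def A_def by simp
qed

end
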